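(* For every convergent sequence $\{(P_n,\prec_n)\}_{n\in\mathbb{N}}$ of posets there is a poset kernel of the form $([0,1],\mathcal{B},\lambda,<,U)$, where $\mathcal{B}$ is the Borel $\sigma$-algebra of $[0,1]$, $\lambda$ is the Lebesgue measure and $<$ is the standard order on $[0,1]$, such that $$t(P,U)=\lim_{n\to\infty} t(P,P_n)\quad\text{for every poset } P.$$
   Context: A poset is a pair $(P,\prec)$ where $P$ is a finite ground set and $\prec$ is a strict order relation on $P$ (transitive, and no $a\in P$ satisfies $a\prec a$); it is abbreviated to $P$. A map $f:P\to Q$ (not necessarily injective) is a homomorphism from $(P,\prec)$ to $(Q,\ll)$ if $f(x)\ll f(y)$ for all $x,y\in P$ with $x\prec y$. The density $t(P,Q)$ is the number of homomorphisms from $(P,\prec)$ to $(Q,\ll)$ divided by the total number of maps $P\to Q$. A sequence of posets $\{(P_n,\prec_n)\}_{n\in\mathbb{N}}$ converges (is convergent) if $|P_n|\to\infty$ and $\{t(P,P_n)\}_{n\in\mathbb{N}}$ converges for every poset $P$. An ordered probability space $(S,\mathcal{F},\mu,\vartriangleleft)$ is a probability space $(S,\mathcal{F},\mu)$ equipped with a strict order relation $\vartriangleleft$ on $S$ such that $\{(x,y): x\vartriangleleft y\}\in\mathcal{F}\otimes\mathcal{F}$ (the product $\sigma$-algebra). A (poset) kernel is a 5-tuple $(S,\mathcal{F},\mu,\vartriangleleft,W)$ where $(S,\mathcal{F},\mu,\vartriangleleft)$ is an ordered probability space and $W:S\times S\to[0,1]$ is $\mathcal{F}\otimes\mathcal{F}$-measurable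 and satisfies, for all $x,y,z\in S$: (i) $W(x,y)>0\Rightarrow x\vartriangleleft y$; (ii) $W(x,y)>0$ and $W(y,z)>0$ $\Rightarrow$ $W(x,z)=1$. The density of a poset $(P,\prec)$ in a kernel $(S,\mathcal{F},\mu,\vartriangleleft,W)$ is $$t(P,W):=\int_{S^{|P|}}\ \prod_{a,b\in P,\ a\prec b} W(x_a,x_b)\ \prod_{a\in P}\mathrm{d}\mu(x_a).$$ *)

theory Defs
  imports "HOL-Probability.Probability"
begin

text \<open>A finite ground set \<open>P\<close> together with a strict order relation \<open>r\<close> on it.\<close>

definition finite_poset :: "'a set \<Rightarrow> 'a rel \<Rightarrow> bool" where
  "finite_poset P r \<longleftrightarrow> finite P \<and> r \<subseteq> P \<times> P \<and> trans r \<and> irrefl r"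

text \<open>Maps \<open>P \<rightarrow> Q\<close> are the extensional functions \<open>P \<rightarrow>\<^sub>E Q\<close>, so that each of them is counted once.\<close>

definition poset_homs :: "'a set \<Rightarrow> 'a rel \<Rightarrow> 'b set \<Rightarrow> 'b rel \<Rightarrow> ('a \<Rightarrow> 'b) set" where
  "poset_homs P r Q s = {f \<in> P \<rightarrow>\<^sub>E Q. \<forall>x\<in>P. \<forall>y\<in>P. (x, y) \<in> r \<longrightarrow> (f x, f y) \<in> s}"

definition poset_density :: "'a set \<Rightarrow> 'a rel \<Rightarrow> 'b set \<Rightarrow> 'b rel \<Rightarrow> real" where
  "poset_density P r Q s = real (card (poset_homs P r Q s)) / real (card (P \<rightarrow>\<^sub>E Q))"

text \<open>
  The test posets range over finite posets with ground set in \<^typ>\<open>nat\<close>. This is no restriction: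
  see \<open>finite_poset_nat_representative\<close> at the end of this theory.
\<close>

definition poset_convergent :: "(nat \<Rightarrow> 'a set) \<Rightarrow> (nat \<Rightarrow> 'a rel) \<Rightarrow> bool" where
  "poset_convergent P r \<longleftrightarrow>
     filterlim (\<lambda>n. card (P n)) at_top sequentially \<and>
     (\<forall>(Q :: nat set) s. finite_poset Q s \<longrightarrow> convergent (\<lambda>n. poset_density Q s (P n) (r n)))"

locale ordered_prob_space = prob_space M
  for M :: "'a measure" +
  fixes lt :: "'a rel"
  assumes lt_measurable: "lt \<in> sets (M \<Otimes>\<^sub>M M)"
    and lt_trans: "trans lt"
    and lt_irrefl: "irrefl lt"

locale poset_kernel = ordered_prob_space M lt
  for M :: "'a measure" and lt :: "'a rel" +
  fixes W :: "'a \<Rightarrow> 'a \<Rightarrow> real"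
  assumes W_measurable: "(\<lambda>(x, y). W x y) \<in> borel_measurable (M \<Otimes>\<^sub>M M)"
    and W_range: "\<lbrakk>x \<in> space M; y \<in> space M\<rbrakk> \<Longrightarrow> W x y \<in> {0..1}"
    and W_pos_imp_lt: "\<lbrakk>x \<in> space M; y \<in> space M; W x y > 0\<rbrakk> \<Longrightarrow> (x, y) \<in> lt"
    and W_pos_trans: "\<lbrakk>x \<in> space M; y \<in> space M; z \<in> space M; W x y > 0; W y z > 0\<rbrakk>
                        \<Longrightarrow> W x z = 1"

definition kernel_density :: "'a set \<Rightarrow> 'a rel \<Rightarrow> 'b measure \<Rightarrow> ('b \<Rightarrow> 'b \<Rightarrow> real) \<Rightarrow> real" where
  "kernel_density P r M W = (\<integral>x. (\<Prod>(a, b)\<in>r. W (x a) (x b)) \<partial>(\<Pi>\<^sub>M a\<in>P. M))"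

text \<open>Lebesgue measure on the Borel \<open>\<sigma>\<close>-algebra of \<open>[0,1]\<close>.\<close>

definition unit_interval_measure :: "real measure" where
  "unit_interval_measure = restrict_space lborel {0..1}"

definition unit_interval_less :: "real rel" where
  "unit_interval_less = {(x, y). x \<in> {0..1} \<and> y \<in> {0..1} \<and> x < y}"

lemma finite_poset_iso:
  assumes "finite_poset P r" "inj_on h P"
  shows "finite_poset (h ` P) (map_prod h h ` r)"
proof -
  have fin: "finite P" and sub: "r \<subseteq> P \<times> P" and tr: "trans r" and irr: "irrefl r"
    using assms(1) by (auto simp: finite_poset_def)
  have "trans (map_prod h h ` r)"
  proof (rule transI)
    fix x y z assume "(x, y) \<in> map_prod h h ` r" "(y, z) \<in> map_prod h h ` r"
    then obtain a b b' c where ab: "(a, b) \<in> r" "x = h a" "y = h b"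
      and bc: "(b', c) \<in> r" "y = h b'" "z = h c" by auto
    have "b = b'" using ab bc sub assms(2) by (auto dest: inj_onD)
    then have "(a, c) \<in> r" using ab bc tr by (auto dest: transD)
    then show "(x, z) \<in> map_prod h h ` r" using ab bc by (auto intro!: image_eqI)
  qed
  moreover have "irrefl (map_prod h h ` r)"
  proof (rule irreflI, rule notI)
    fix x assume "(x, x) \<in> map_prod h h ` r"
    then obtain a b where ab: "(a, b) \<in> r" "x = h a" "x = h b" by auto
    then have "a = b" using sub assms(2) by (auto dest: inj_onD)
    then show False using ab irr by (auto simp: irrefl_def)
  qed
  ultimately show ?thesis using fin sub by (auto simp: finite_poset_def)
qed

lemma poset_density_iso:
  assumes "finite_poset P r" "inj_on h P"
  shows "poset_density (h ` P) (map_prod h h ` r) Q s = poset_density P r Q s"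
proof -
  have fin: "finite P" and sub: "r \<subseteq> P \<times> P" using assms(1) by (auto simp: finite_poset_def)
  define g where "g = the_inv_into P h"
  have g: "g (h x) = x" if "x \<in> P" for x
    using that assms(2) by (simp add: g_def the_inv_into_f_f)
  have mem: "(h x, h y) \<in> map_prod h h ` r \<longleftrightarrow> (x, y) \<in> r" if "x \<in> P" "y \<in> P" for x y
    using that sub assms(2) by (force simp: inj_on_eq_iff)
  have "bij_betw (\<lambda>f. restrict (f \<circ> h) P)
          (poset_homs (h ` P) (map_prod h h ` r) Q s) (poset_homs P r Q s)"
    by (rule bij_betw_byWitness[where f' = "\<lambda>f. restrict (f \<circ> g) (h ` P)"])
       (use mem g in \<open>auto simp: poset_homs_def fun_eq_iff PiE_def extensional_def\<close>)
  then have "card (poset_homs (h ` P) (map_prod h h ` r) Q s) = card (poset_homs P r Q s)"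
    by (rule bij_betw_same_card)
  moreover have "card (h ` P \<rightarrow>\<^sub>E Q) = card (P \<rightarrow>\<^sub>E Q)"
    using fin assms(2) by (simp add: card_PiE card_image)
  ultimately show ?thesis by (simp add: poset_density_def)
qed

lemma kernel_density_iso:
  assumes "finite_poset P r" "inj_on h P" "poset_kernel M lt W"
  shows "kernel_density (h ` P) (map_prod h h ` r) M W = kernel_density P r M W"
proof -
  interpret poset_kernel M lt W by fact
  have fin: "finite P" and sub: "r \<subseteq> P \<times> P" using assms(1) by (auto simp: finite_poset_def)
  have inj: "inj_on (map_prod h h) r"
    using assms(2) sub by (intro inj_on_subset[OF map_prod_inj_on[of h P h P]]) auto
  have eq: "distr (\<Pi>\<^sub>M a\<in>h ` P. M) (\<Pi>\<^sub>M a\<in>P. M) (\<lambda>x. \<lambda>a\<in>P. x (h a)) = (\<Pi>\<^sub>M a\<in>P. M)"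
    by (rule distr_PiM_reindex) (use assms(2) prob_space_axioms in auto)
  have Wm: "(\<lambda>x. W (x a) (x b)) \<in> borel_measurable (\<Pi>\<^sub>M a\<in>P. M)" if "(a, b) \<in> r" for a b
  proof -
    have "a \<in> P" "b \<in> P" using that sub by auto
    then have "(\<lambda>x. (x a, x b)) \<in> (\<Pi>\<^sub>M a\<in>P. M) \<rightarrow>\<^sub>M M \<Otimes>\<^sub>M M" by measurable
    from measurable_compose[OF this W_measurable] show ?thesis by simp
  qed
  have m: "(\<lambda>x. \<Prod>(a, b)\<in>r. W (x a) (x b)) \<in> borel_measurable (\<Pi>\<^sub>M a\<in>P. M)"
    by (rule borel_measurable_prod) (use Wm in auto)
  have m2: "(\<lambda>x. \<lambda>a\<in>P. x (h a)) \<in> (\<Pi>\<^sub>M a\<in>h ` P. M) \<rightarrow>\<^sub>M (\<Pi>\<^sub>M a\<in>P. M)"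
    by measurable
  have "kernel_density P r M W
      = (\<integral>x. (\<Prod>(a, b)\<in>r. W ((\<lambda>a\<in>P. x (h a)) a) ((\<lambda>a\<in>P. x (h a)) b)) \<partial>(\<Pi>\<^sub>M a\<in>h ` P. M))"
    unfolding kernel_density_def by (subst eq[symmetric], subst integral_distr[OF m2 m]) simp
  also have "\<dots> = (\<integral>x. (\<Prod>(a, b)\<in>map_prod h h ` r. W (x a) (x b)) \<partial>(\<Pi>\<^sub>M a\<in>h ` P. M))"
    by (rule Bochner_Integration.integral_cong[OF refl], subst prod.reindex[OF inj])
       (use sub in \<open>auto intro!: prod.cong\<close>)
  finally show ?thesis by (simp add: kernel_density_def)
qed

lemma finite_poset_nat_representative:
  fixes P :: "'a set"
  assumes "finite_poset P r"
  obtains P' :: "nat set" and r' where "finite_poset P' r'"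
    "\<And>(Q :: 'b set) s. poset_density P' r' Q s = poset_density P r Q s"
    "\<And>(M :: 'c measure) lt W. poset_kernel M lt W \<Longrightarrow> kernel_density P' r' M W = kernel_density P r M W"
proof -
  have "finite P" using assms by (simp add: finite_poset_def)
  then obtain h :: "'a \<Rightarrow> nat" where "inj_on h P"
    using finite_imp_inj_to_nat_seg by blast
  with assms show ?thesis
    using that[of "h ` P" "map_prod h h ` r"]
      finite_poset_iso poset_density_iso kernel_density_iso by blast
qed

end

theory Submission
  imports Defs
begin

text \<open>
  Fix a finite poset and a list of reference points \<open>z\<^sub>1, \<dots>, z\<^sub>m\<close> in it. Recording for each element
  \<open>x\<close> whether it lies above, below, or is incomparable to each \<open>z\<^sub>k\<close>, and reading the answers as
  the digits of a number in base 3, gives a map that is monotone for the poset order, so this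
  lexicographic order of types is what becomes the order of \<open>[0,1]\<close>. A random list of reference
  points is automatically regular: replacing the comparability relation by its averages over pairs of
  types changes the density of a fixed poset by at most the square root of the energy gained by
  adding a few more random reference points, and the energies form a bounded increasing sequence.
  Hence the reference lists can be chosen such that these errors are square summable in the level
  \<open>m\<close>, uniformly along the sequence.

  After passing to a subsequence, the frequencies of types and the edge frequencies between types
  converge. Laying out the types as nested intervals of \<open>[0,1]\<close> in numerical order turns the limits
  into a bounded martingale of step kernels on the unit square, which converges almost everywhere
  along a subsequence to a kernel \<open>W\<close> with the right densities. Comparing the densities of the path
  and of the chain on three points shows that \<open>W(x,y) > 0\<close> and \<open>W(y,z) > 0\<close> imply \<open>W(x,z) = 1\<close>
  almost everywhere; keeping the values of \<open>W\<close> only at suitable Lebesgue points makes this hold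
  everywhere and forces \<open>x < y\<close> wherever the kernel is positive.
\<close>

section \<open>Averaging over the blocks of a partition\<close>

text \<open>The parts of a regular partition have to become intervals in an order that no edge
  reverses; partitions by types have this property built in, so only such partitions are refined.
  Replacing one edge of the fixed poset leaves \<open>card Q - 2\<close> other vertices, whose
  images act as extra reference points, so regularity is needed only against
  \<open>k = card Q - 2\<close> further points. Along a random list the expected gains from k
  further points telescope over all levels to at most k, and weights 1/2^k let one list serve every
  k. The resulting bound on the sum of squared errors does not depend on the index n of the
  sequence, so it survives n \<rightarrow> \<infinity> at fixed level and then forces convergence in
  the level. The kernel conditions hold at every point, while limits control only almost every
  point. The way out is to define good points through averages over cells: an almost everywhere
  statement, integrated over cells, then says something about each single pair. Irreflexivity rests
  on asymmetry: at most half of the pairs inside one type are edges, while composing positive values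
  would force density 1.\<close>

text \<open>The conditional expectation of \<open>h\<close> under the uniform measure on
  \<open>X\<close>, given the partition into fibres of \<open>l\<close>. With partitions encoded by
  labellings, "l' refines l" is the implication from equal \<open>l'\<close> to equal
  \<open>l\<close>. A label not attained in \<open>X\<close> gives 0.\<close>

definition block_avg :: "'b set \<Rightarrow> ('b \<Rightarrow> 'c) \<Rightarrow> ('b \<Rightarrow> real) \<Rightarrow> 'b \<Rightarrow> real" where
  "block_avg X l h x = (\<Sum>y\<in>{y \<in> X. l y = l x}. h y) / real (card {y \<in> X. l y = l x})"

lemma block_avg_cong: "l x = l y \<Longrightarrow> block_avg X l h x = block_avg X l h y"
  by (simp add: block_avg_def)

lemma block_avg_range:
  assumes "\<And>y. y \<in> X \<Longrightarrow> h y \<in> {0..1}"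
  shows "block_avg X l h x \<in> {0..1}"
proof -
  have "(\<Sum>y\<in>{y \<in> X. l y = l x}. h y) \<le> real (card {y \<in> X. l y = l x}) * 1"
    by (rule sum_bounded_above) (use assms in auto)
  moreover have "0 \<le> (\<Sum>y\<in>{y \<in> X. l y = l x}. h y)"
    by (rule sum_nonneg) (use assms in auto)
  ultimately show ?thesis
    by (auto simp: block_avg_def divide_le_eq_1)
qed

text \<open>The defining property of a conditional expectation: on one block \<open>F\<close> is a
  constant factor, and the block average has the same block sum as \<open>h\<close>.\<close>

lemma sum_block_avg_mult:
  assumes fin: "finite X" and inv: "\<And>x y. x \<in> X \<Longrightarrow> y \<in> X \<Longrightarrow> l x = l y \<Longrightarrow> F x = F y"
  shows "(\<Sum>x\<in>X. block_avg X l h x * F x) = (\<Sum>x\<in>X. h x * F x)"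
proof -
  have eq: "(\<Sum>x\<in>{x \<in> X. l x = c}. block_avg X l h x * F x) = (\<Sum>x\<in>{x \<in> X. l x = c}. h x * F x)"
    if c: "c \<in> l ` X" for c
  proof -
    define Y where "Y = {x \<in> X. l x = c}"
    obtain x0 where x0: "x0 \<in> Y" using c unfolding Y_def by blast
    have Y: "finite Y" "card Y > 0" using x0 fin by (auto simp: Y_def card_gt_0_iff)
    have "F x = F x0" if "x \<in> Y" for x using that x0 inv by (auto simp: Y_def)
    moreover have "block_avg X l h x = (\<Sum>y\<in>Y. h y) / card Y" if "x \<in> Y" for x
      using that by (simp add: block_avg_def Y_def)
    ultimately have "(\<Sum>x\<in>Y. block_avg X l h x * F x) = (\<Sum>x\<in>Y. (\<Sum>y\<in>Y. h y) / card Y * F x0)"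
      and "(\<Sum>x\<in>Y. h x * F x) = (\<Sum>x\<in>Y. h x * F x0)"
      by (auto intro!: sum.cong)
    then show ?thesis unfolding Y_def[symmetric]
      using Y by (simp add: sum_distrib_right)
  qed
  have "(\<Sum>x\<in>X. block_avg X l h x * F x)
      = (\<Sum>c\<in>l ` X. \<Sum>x\<in>{x \<in> X. l x = c}. block_avg X l h x * F x)"
    by (rule sum.image_gen[OF fin])
  also have "\<dots> = (\<Sum>c\<in>l ` X. \<Sum>x\<in>{x \<in> X. l x = c}. h x * F x)"
    by (rule sum.cong) (use eq in auto)
  also have "\<dots> = (\<Sum>x\<in>X. h x * F x)"
    by (rule sum.image_gen[OF fin, symmetric])
  finally show ?thesis .
qed

text \<open>The squared L2 norm of the conditional expectation, i.e. the index of a partition in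
  regularity lemmas.\<close>

definition energy :: "'b set \<Rightarrow> ('b \<Rightarrow> 'c) \<Rightarrow> ('b \<Rightarrow> real) \<Rightarrow> real" where
  "energy X l h = (\<Sum>x\<in>X. (block_avg X l h x)\<^sup>2) / real (card X)"

lemma energy_range:
  assumes "\<And>y. y \<in> X \<Longrightarrow> h y \<in> {0..1}"
  shows "energy X l h \<in> {0..1}"
proof -
  have r: "block_avg X l h x \<in> {0..1}" for x by (rule block_avg_range) (use assms in auto)
  have "(\<Sum>x\<in>X. (block_avg X l h x)\<^sup>2) \<le> real (card X) * 1"
    by (rule sum_bounded_above) (use r in \<open>auto intro!: power_le_one\<close>)
  moreover have "0 \<le> (\<Sum>x\<in>X. (block_avg X l h x)\<^sup>2)" by (rule sum_nonneg) auto
  ultimately show ?thesis by (auto simp: energy_def divide_le_eq_1)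
qed

text \<open>Pythagoras: the coarse average is the orthogonal projection of the fine one, so the
  mixed term equals the coarse square.\<close>

lemma energy_diff:
  assumes fin: "finite X" and ref: "\<And>x y. x \<in> X \<Longrightarrow> y \<in> X \<Longrightarrow> l' x = l' y \<Longrightarrow> l x = l y"
  shows "energy X l' h - energy X l h
    = (\<Sum>x\<in>X. (block_avg X l' h x - block_avg X l h x)\<^sup>2) / real (card X)"
proof -
  let ?F = "block_avg X l h" and ?G = "block_avg X l' h"
  have F': "?F x = ?F y" if "x \<in> X" "y \<in> X" "l' x = l' y" for x y
    using ref[OF that] by (rule block_avg_cong)
  have "(\<Sum>x\<in>X. ?G x * ?F x) = (\<Sum>x\<in>X. h x * ?F x)"
    by (rule sum_block_avg_mult[OF fin]) (rule F')
  moreover have "(\<Sum>x\<in>X. ?F x * ?F x) = (\<Sum>x\<in>X. h x * ?F x)"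
    by (rule sum_block_avg_mult[OF fin]) (rule block_avg_cong)
  ultimately have "(\<Sum>x\<in>X. (?G x - ?F x)\<^sup>2) = (\<Sum>x\<in>X. (?G x)\<^sup>2) - (\<Sum>x\<in>X. (?F x)\<^sup>2)"
    by (simp add: power2_eq_square algebra_simps sum.distrib sum_subtractf flip: sum_distrib_left)
  then show ?thesis by (simp add: energy_def diff_divide_distrib)
qed

lemma sum_le_sqrt_mean:
  fixes f :: "'b \<Rightarrow> real"
  assumes "finite X"
  shows "(\<Sum>x\<in>X. \<bar>f x\<bar>) \<le> real (card X) * sqrt ((\<Sum>x\<in>X. (f x)\<^sup>2) / real (card X))"
proof -
  have "(\<Sum>x\<in>X. \<bar>f x\<bar> * 1)\<^sup>2 \<le> (\<Sum>x\<in>X. \<bar>f x\<bar>\<^sup>2) * (\<Sum>x\<in>X. 1\<^sup>2)"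
    by (rule Cauchy_Schwarz_ineq_sum)
  then have "(\<Sum>x\<in>X. \<bar>f x\<bar>)\<^sup>2 \<le> (\<Sum>x\<in>X. (f x)\<^sup>2) * real (card X)"
    by simp
  then have "(\<Sum>x\<in>X. \<bar>f x\<bar>) \<le> sqrt ((\<Sum>x\<in>X. (f x)\<^sup>2) * real (card X))"
    by (rule real_le_rsqrt)
  also have "\<dots> = real (card X) * sqrt ((\<Sum>x\<in>X. (f x)\<^sup>2) / real (card X))"
    by (cases "card X = 0") (simp_all add: real_sqrt_mult real_sqrt_divide field_simps)
  finally show ?thesis .
qed

text \<open>Since \<open>F\<close> is constant on the finer blocks, \<open>h\<close> may be replaced
  by its finer average. What remains is a difference of two averages, and the energy gain is its
  squared L2 norm.\<close>

lemma sum_block_diff_le: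
  assumes fin: "finite X" and ref: "\<And>x y. x \<in> X \<Longrightarrow> y \<in> X \<Longrightarrow> l' x = l' y \<Longrightarrow> l x = l y"
    and inv: "\<And>x y. x \<in> X \<Longrightarrow> y \<in> X \<Longrightarrow> l' x = l' y \<Longrightarrow> F x = F y"
    and F: "\<And>x. x \<in> X \<Longrightarrow> F x \<in> {0..1}"
  shows "\<bar>\<Sum>x\<in>X. (h x - block_avg X l h x) * F x\<bar>
    \<le> real (card X) * sqrt (energy X l' h - energy X l h)"
proof -
  have "(\<Sum>x\<in>X. block_avg X l' h x * F x) = (\<Sum>x\<in>X. h x * F x)"
    by (rule sum_block_avg_mult[OF fin]) (rule inv)
  then have "(\<Sum>x\<in>X. (h x - block_avg X l h x) * F x)
      = (\<Sum>x\<in>X. (block_avg X l' h x - block_avg X l h x) * F x)"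
    by (simp add: left_diff_distrib sum_subtractf)
  also have "\<bar>\<dots>\<bar> \<le> (\<Sum>x\<in>X. \<bar>block_avg X l' h x - block_avg X l h x\<bar>)"
    by (rule order_trans[OF sum_abs]) (use F in \<open>auto intro!: sum_mono simp: abs_mult mult_left_le\<close>)
  also have "\<dots> \<le> real (card X) * sqrt (energy X l' h - energy X l h)"
  proof -
    have "energy X l' h - energy X l h
        = (\<Sum>x\<in>X. (block_avg X l' h x - block_avg X l h x)\<^sup>2) / real (card X)"
      by (rule energy_diff[OF fin]) (rule ref)
    then show ?thesis using sum_le_sqrt_mean[OF fin] by simp
  qed
  finally show ?thesis .
qed

section \<open>Types relative to a list of reference points\<close>

text \<open>The value 1 covers both incomparability and \<open>x = z\<close>. Below, incomparable,
  above are numbered increasingly so that the digit is monotone in \<open>x\<close>.\<close>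

definition digit :: "'a rel \<Rightarrow> 'a \<Rightarrow> 'a \<Rightarrow> nat" where
  "digit r z x = (if (z, x) \<in> r then 2 else if (x, z) \<in> r then 0 else 1)"

definition code :: "'a rel \<Rightarrow> 'a list \<Rightarrow> 'a \<Rightarrow> nat" where
  "code r zs x = foldl (\<lambda>c z. 3 * c + digit r z x) 0 zs"

lemma code_Nil [simp]: "code r [] x = 0"
  and code_snoc: "code r (zs @ [z]) x = 3 * code r zs x + digit r z x"
  by (simp_all add: code_def)

lemma digit_less: "digit r z x < 3"
  by (simp add: digit_def)

text \<open>Asymmetry excludes the case in which the first test of \<open>digit\<close> hides the
  second, so a digit determines both relations to \<open>z\<close>.\<close>

lemma digit_eqD:
  assumes "asym r" "digit r z x = digit r z y"
  shows "(z, x) \<in> r \<longleftrightarrow> (z, y) \<in> r" "(x, z) \<in> r \<longleftrightarrow> (y, z) \<in> r"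
  using assms asymD[OF assms(1)] by (auto simp: digit_def split: if_splits)

lemma code_less: "code r zs x < 3 ^ length zs"
proof (induction zs rule: rev_induct)
  case (snoc z zs)
  then show ?case using digit_less[of r z x] by (simp add: code_snoc)
qed simp

lemma base3_eq_iff: "d < 3 \<Longrightarrow> d' < 3 \<Longrightarrow> 3 * c + d = 3 * c' + d' \<longleftrightarrow> c = c' \<and> d = d'"
  for c c' d d' :: nat
  by presburger

lemma code_snoc_eqD:
  assumes "code r (zs @ [z]) x = code r (zs @ [z]) y"
  shows "code r zs x = code r zs y" "digit r z x = digit r z y"
  using assms base3_eq_iff[OF digit_less[of r z x] digit_less[of r z y]] by (simp_all add: code_snoc)

lemma code_append_eqD:
  "code r (zs @ zs') x = code r (zs @ zs') y \<Longrightarrow> code r zs x = code r zs y"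
proof (induction zs' rule: rev_induct)
  case (snoc z zs')
  then show ?case
    using code_snoc_eqD(1)[of r "zs @ zs'" z x y] by simp
qed simp

lemma code_eq_digitD:
  "code r zs x = code r zs y \<Longrightarrow> z \<in> set zs \<Longrightarrow> digit r z x = digit r z y"
proof (induction zs rule: rev_induct)
  case (snoc z' zs)
  from code_snoc_eqD[OF snoc.prems(1)] snoc.IH snoc.prems(2) show ?case by auto
qed simp

text \<open>By transitivity every single digit is monotone, and a digitwise larger word has the
  larger value.\<close>

lemma code_mono:
  assumes "trans r" "(x, y) \<in> r"
  shows "code r zs x \<le> code r zs y"
proof (induction zs rule: rev_induct)
  case (snoc z zs)
  moreover have "digit r z x \<le> digit r z y"
    using assms by (auto simp: digit_def dest: transD)
  ultimately show ?case by (simp add: code_snoc)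
qed simp

text \<open>The expectation of \<open>h\<close> after appending \<open>k\<close> independent uniform elements of \<open>V\<close> to the list.\<close>

primrec iter_avg :: "'a set \<Rightarrow> ('a list \<Rightarrow> real) \<Rightarrow> nat \<Rightarrow> 'a list \<Rightarrow> real" where
  "iter_avg V h 0 zs = h zs"
| "iter_avg V h (Suc k) zs = (\<Sum>x\<in>V. iter_avg V h k (zs @ [x])) / real (card V)"

lemma sum_PiE_insert:
  assumes "a \<notin> R"
  shows "(\<Sum>x\<in>PiE (insert a R) (\<lambda>_. V). F x) = (\<Sum>u\<in>V. \<Sum>z\<in>PiE R (\<lambda>_. V). F (z(a := u)))"
proof -
  have "inj_on (\<lambda>(u, z). z(a := u)) (V \<times> PiE R (\<lambda>_. V))"
    using assms by (auto intro!: inj_combinator)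
  then show ?thesis
    by (simp add: PiE_insert_eq sum.reindex sum.cartesian_product case_prod_unfold)
qed

text \<open>Links two encodings of independent uniform points: assignments to a vertex set, as in
  the counting of maps, and extensions of a reference list, as in the energies. The enumeration
  \<open>rs\<close> turns one into the other.\<close>

lemma sum_PiE_map_eq_iter_avg:
  assumes "finite V" "V \<noteq> {}" "distinct rs"
  shows "(\<Sum>z\<in>PiE (set rs) (\<lambda>_. V). h (zs @ map z rs))
    = real (card V) ^ length rs * iter_avg V h (length rs) zs"
  using assms(3)
proof (induction rs arbitrary: zs)
  case (Cons a rs)
  have N: "real (card V) > 0" using assms by (simp add: card_gt_0_iff)
  have "map (z(a := u)) rs = map z rs" for z :: "'b \<Rightarrow> 'a" and u
    using Cons.prems by auto
  then have "(\<Sum>z\<in>PiE (set (a # rs)) (\<lambda>_. V). h (zs @ map z (a # rs)))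
      = (\<Sum>u\<in>V. \<Sum>z\<in>PiE (set rs) (\<lambda>_. V). h ((zs @ [u]) @ map z rs))"
    using Cons.prems by (simp add: sum_PiE_insert)
  also have "\<dots> = (\<Sum>u\<in>V. real (card V) ^ length rs * iter_avg V h (length rs) (zs @ [u]))"
    using Cons.prems by (intro sum.cong refl Cons.IH) simp
  finally show ?case using N by (simp add: sum_distrib_left[symmetric])
qed simp

lemma iter_avg_add: "iter_avg V (iter_avg V h k) m zs = iter_avg V h (m + k) zs"
  by (induction m arbitrary: zs) simp_all

lemma iter_avg_sum:
  "iter_avg V (\<lambda>zs. \<Sum>k\<in>K. w k * h k zs) m zs = (\<Sum>k\<in>K. w k * iter_avg V (h k) m zs)"
proof (induction m arbitrary: zs)
  case (Suc m)
  have "iter_avg V (\<lambda>zs. \<Sum>k\<in>K. w k * h k zs) (Suc m) zs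
      = (\<Sum>x\<in>V. \<Sum>k\<in>K. w k * iter_avg V (h k) m (zs @ [x])) / real (card V)"
    by (simp add: Suc)
  also have "\<dots> = (\<Sum>k\<in>K. \<Sum>x\<in>V. w k * iter_avg V (h k) m (zs @ [x])) / real (card V)"
    by (subst sum.swap) (rule refl)
  also have "\<dots> = (\<Sum>k\<in>K. w k * iter_avg V (h k) (Suc m) zs)"
    by (simp add: sum_divide_distrib sum_distrib_left)
  finally show ?case .
qed simp

lemma iter_avg_diff:
  "iter_avg V (\<lambda>zs. h zs - h' zs) m zs = iter_avg V h m zs - iter_avg V h' m zs"
  by (induction m arbitrary: zs) (simp_all add: sum_subtractf diff_divide_distrib)

lemma iter_avg_range:
  assumes "\<And>zs. h zs \<in> {0..1}"
  shows "iter_avg V h m zs \<in> {0..1}"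
proof (induction m arbitrary: zs)
  case (Suc m)
  have "(\<Sum>x\<in>V. iter_avg V h m (zs @ [x])) \<le> real (card V) * 1"
    by (rule sum_bounded_above) (use Suc in auto)
  moreover have "0 \<le> (\<Sum>x\<in>V. iter_avg V h m (zs @ [x]))" by (rule sum_nonneg) (use Suc in auto)
  ultimately show ?case by (auto simp: divide_le_eq_1)
qed (use assms in auto)

lemma iter_avg_ge:
  assumes "finite V" "V \<noteq> {}" "\<And>zs x. h zs \<le> h (zs @ [x])"
  shows "h zs \<le> iter_avg V h m zs"
proof (induction m arbitrary: zs)
  case (Suc m)
  have "real (card V) * h zs \<le> (\<Sum>x\<in>V. iter_avg V h m (zs @ [x]))"
    by (rule sum_bounded_below) (use Suc assms(3) order_trans in blast)
  then show ?case using assms by (simp add: field_simps card_gt_0_iff)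
qed simp

lemma exists_le_mean:
  fixes f :: "'a \<Rightarrow> real"
  assumes "finite V" "V \<noteq> {}"
  shows "\<exists>x\<in>V. f x \<le> (\<Sum>x\<in>V. f x) / real (card V)"
proof (rule ccontr)
  assume "\<not> ?thesis"
  then have "(\<Sum>x\<in>V. (\<Sum>x\<in>V. f x) / real (card V)) < (\<Sum>x\<in>V. f x)"
    using assms by (intro sum_strict_mono) auto
  then show False using assms by simp
qed

text \<open>The method of conditional expectations: each new point is chosen so that the expected
  remaining sum does not exceed its mean. All terms use prefixes of one list, so a single list
  serves all levels at once.\<close>

lemma exists_list_sum_le_iter_avg:
  assumes "finite V" "V \<noteq> {}"
  shows "\<exists>xs. set xs \<subseteq> V \<and> length xs = M \<and>
    (\<Sum>m<M. h (zs @ take m xs)) \<le> (\<Sum>m<M. iter_avg V h m zs)"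
proof (induction M arbitrary: zs)
  case (Suc M)
  from exists_le_mean[OF assms, of "\<lambda>x. \<Sum>m<M. iter_avg V h m (zs @ [x])"]
  obtain x where x: "x \<in> V"
    "(\<Sum>m<M. iter_avg V h m (zs @ [x])) \<le> (\<Sum>x\<in>V. \<Sum>m<M. iter_avg V h m (zs @ [x])) / real (card V)"
    by blast
  have swap: "(\<Sum>x\<in>V. \<Sum>m<M. iter_avg V h m (zs @ [x])) / real (card V)
      = (\<Sum>m<M. iter_avg V h (Suc m) zs)"
    by (subst sum.swap) (simp add: sum_divide_distrib)
  from Suc[of "zs @ [x]"] obtain xs where xs: "set xs \<subseteq> V" "length xs = M"
    "(\<Sum>m<M. h ((zs @ [x]) @ take m xs)) \<le> (\<Sum>m<M. iter_avg V h m (zs @ [x]))"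
    by blast
  have "(\<Sum>m<Suc M. h (zs @ take m (x # xs))) \<le> (\<Sum>m<Suc M. iter_avg V h m zs)"
    unfolding sum.lessThan_Suc_shift using x(2) xs unfolding swap by simp
  then show ?case using x xs by (intro exI[of _ "x # xs"]) auto
qed simp


section \<open>The counting lemma\<close>

definition adj :: "'a rel \<Rightarrow> 'a \<times> 'a \<Rightarrow> real" where
  "adj r p = of_bool (p \<in> r)"

text \<open>A pair is labelled by the pair of its types, so each block of
  \<open>V \<times> V\<close> is a product of two type classes and the average is the edge density
  between them.\<close>

definition code_avg :: "'a set \<Rightarrow> 'a rel \<Rightarrow> 'a list \<Rightarrow> 'a \<times> 'a \<Rightarrow> real" where
  "code_avg V r zs = block_avg (V \<times> V) (map_prod (code r zs) (code r zs)) (adj r)"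

definition code_energy :: "'a set \<Rightarrow> 'a rel \<Rightarrow> 'a list \<Rightarrow> real" where
  "code_energy V r zs = energy (V \<times> V) (map_prod (code r zs) (code r zs)) (adj r)"

lemma adj_range: "adj r p \<in> {0..1}"
  by (simp add: adj_def)

lemma code_avg_range: "code_avg V r zs p \<in> {0..1}"
  unfolding code_avg_def by (rule block_avg_range) (rule adj_range)

lemma code_avg_cong:
  "code r zs x = code r zs x' \<Longrightarrow> code r zs y = code r zs y' \<Longrightarrow>
    code_avg V r zs (x, y) = code_avg V r zs (x', y')"
  unfolding code_avg_def by (rule block_avg_cong) simp

lemma code_energy_range: "code_energy V r zs \<in> {0..1}"
  unfolding code_energy_def by (rule energy_range) (rule adj_range)

lemma code_energy_append_ge:
  assumes "finite V"
  shows "code_energy V r zs \<le> code_energy V r (zs @ zs')"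
proof -
  have "code_energy V r (zs @ zs') - code_energy V r zs \<ge> 0"
    unfolding code_energy_def
    by (subst energy_diff) (use assms in \<open>auto intro!: divide_nonneg_nonneg sum_nonneg dest: code_append_eqD\<close>)
  then show ?thesis by simp
qed

section \<open>Replacing edges by edge densities, one at a time\<close>

lemma sum_PiE_insert2:
  assumes "a \<noteq> b" "a \<notin> R" "b \<notin> R"
  shows "(\<Sum>x\<in>PiE (insert a (insert b R)) (\<lambda>_. V). F x)
    = (\<Sum>z\<in>PiE R (\<lambda>_. V). \<Sum>(u, v)\<in>V \<times> V. F (z(b := v, a := u)))"
proof -
  have "(\<Sum>x\<in>PiE (insert a (insert b R)) (\<lambda>_. V). F x)
      = (\<Sum>u\<in>V. \<Sum>v\<in>V. \<Sum>z\<in>PiE R (\<lambda>_. V). F (z(b := v, a := u)))"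
    using assms by (simp add: sum_PiE_insert)
  also have "\<dots> = (\<Sum>(u, v)\<in>V \<times> V. \<Sum>z\<in>PiE R (\<lambda>_. V). F (z(b := v, a := u)))"
    by (rule sum.cartesian_product)
  also have "\<dots> = (\<Sum>z\<in>PiE R (\<lambda>_. V). \<Sum>(u, v)\<in>V \<times> V. F (z(b := v, a := u)))"
    unfolding case_prod_unfold by (rule sum.swap)
  finally show ?thesis .
qed

text \<open>Interpolates between the number of homomorphisms (\<open>s1\<close> empty) and the count
  in the averaged structure (\<open>s2\<close> empty). It is not normalised by the number of
  maps.\<close>

definition hybrid_sum :: "'a set \<Rightarrow> 'a rel \<Rightarrow> 'a list \<Rightarrow> 'q set \<Rightarrow> 'q rel \<Rightarrow> 'q rel \<Rightarrow> real" where
  "hybrid_sum V r zs Q s1 s2 = (\<Sum>x\<in>PiE Q (\<lambda>_. V).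
     (\<Prod>(a, b)\<in>s1. code_avg V r zs (x a, x b)) * (\<Prod>(a, b)\<in>s2. adj r (x a, x b)))"

text \<open>
  Fix the images \<open>z\<close> of all vertices other than \<open>a\<close> and \<open>b\<close>. The product of the remaining factors
  then depends only on the types of the images of \<open>a\<close> and \<open>b\<close> relative to the reference list extended
  by \<open>z\<close>. So the adjacency relation may be replaced by its average over this finer partition, and
  Cauchy--Schwarz bounds the change by the energy increment.
\<close>

lemma hybrid_sum_step:
  assumes V: "finite V" "V \<noteq> {}" and r: "asym r" and Q: "finite Q"
    and s: "insert (a, b) (s1 \<union> s2) \<subseteq> Q \<times> Q" "(a, b) \<notin> s1" "(a, b) \<notin> s2"
    and asym: "asym (insert (a, b) (s1 \<union> s2))"
  shows "\<bar>hybrid_sum V r zs Q s1 (insert (a, b) s2) - hybrid_sum V r zs Q (insert (a, b) s1) s2\<bar>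
    \<le> real (card V) ^ card Q *
      sqrt (iter_avg V (code_energy V r) (card Q - 2) zs - code_energy V r zs)"
proof -
  define R where "R = Q - {a, b}"
  define \<Phi> where "\<Phi> = (\<lambda>x. (\<Prod>(c, d)\<in>s1. code_avg V r zs (x c, x d)) * (\<Prod>(c, d)\<in>s2. adj r (x c, x d)))"
  define N where "N = real (card V)"
  let ?E = "code_energy V r"
  have N: "N > 0" using V by (simp add: N_def card_gt_0_iff)
  have ab: "a \<noteq> b" "a \<in> Q" "b \<in> Q" using s asym by (auto dest: asymD)
  have fin: "finite s1" "finite s2" using s Q by (auto intro: finite_subset[of _ "Q \<times> Q"])
  have Q_eq: "Q = insert a (insert b R)" "a \<notin> R" "b \<notin> R" "finite R"
    using ab Q by (auto simp: R_def)
  have card_Q: "card Q = card R + 2" using Q_eq ab by simp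
  obtain rs where rs: "set rs = R" "distinct rs" using finite_distinct_list[OF Q_eq(4)] by auto
  have len: "length rs = card R" using rs by (metis distinct_card)
  have inv: "\<Phi> (z(b := v, a := u)) = \<Phi> (z(b := v', a := u'))"
    if c: "code r (zs @ map z rs) u = code r (zs @ map z rs) u'"
          "code r (zs @ map z rs) v = code r (zs @ map z rs) v'" for z u v u' v'
  proof -
    have eq: "code r zs u = code r zs u'" "code r zs v = code r zs v'"
      using c by (auto dest: code_append_eqD)
    have dig: "digit r (z p) u = digit r (z p) u'" "digit r (z p) v = digit r (z p) v'"
      if "p \<in> R" for p
      using c that rs by (auto intro!: code_eq_digitD[of r "zs @ map z rs"])
    let ?x = "z(b := v, a := u)" and ?y = "z(b := v', a := u')"
    \<comment> \<open>No remaining edge joins \<open>a\<close> and \<open>b\<close>: the pair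
      \<open>(a, b)\<close> is excluded by assumption, \<open>(b, a)\<close> and loops by asymmetry.
      So each remaining edge has an endpoint in \<open>R\<close>, whose image is a reference point
      of the extended list.\<close>
    have edge: "(p = a \<and> q \<in> R) \<or> (q = a \<and> p \<in> R) \<or> (p = b \<and> q \<in> R) \<or> (q = b \<and> p \<in> R) \<or> (p \<in> R \<and> q \<in> R)"
      if "(p, q) \<in> s1 \<union> s2" for p q
      using that s asym unfolding R_def by (auto dest: asymD)
    have avg: "code_avg V r zs (?x p, ?x q) = code_avg V r zs (?y p, ?y q)" for p q
      by (rule code_avg_cong) (use eq in auto)
    have adj: "adj r (?x p, ?x q) = adj r (?y p, ?y q)" if "(p, q) \<in> s2" for p q
    proof -
      consider "p = a" "q \<in> R" | "q = a" "p \<in> R" | "p = b" "q \<in> R" | "q = b" "p \<in> R"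
        | "p \<in> R" "q \<in> R"
        using edge[of p q] \<open>(p, q) \<in> s2\<close> by blast
      then have "(?x p, ?x q) \<in> r \<longleftrightarrow> (?y p, ?y q) \<in> r"
      proof cases
        case 1 then show ?thesis using digit_eqD[OF r dig(1)[of q]] Q_eq ab by auto
      next
        case 2 then show ?thesis using digit_eqD[OF r dig(1)[of p]] Q_eq ab by auto
      next
        case 3 then show ?thesis using digit_eqD[OF r dig(2)[of q]] Q_eq ab by auto
      next
        case 4 then show ?thesis using digit_eqD[OF r dig(2)[of p]] Q_eq ab by auto
      next
        case 5 then have "?x p = ?y p" "?x q = ?y q" using Q_eq by auto
        then show ?thesis by (simp only:)
      qed
      then show ?thesis by (simp only: adj_def)
    qed
    show ?thesis unfolding \<Phi>_def
      using avg adj by (intro arg_cong2[of _ _ _ _ "(*)"] prod.cong) auto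
  qed
  have \<Phi>_range: "\<Phi> x \<in> {0..1}" for x
  proof -
    have A: "0 \<le> (case p of (c, d) \<Rightarrow> code_avg V r zs (x c, x d)) \<and> (case p of (c, d) \<Rightarrow> code_avg V r zs (x c, x d)) \<le> 1"
      and B: "0 \<le> (case p of (c, d) \<Rightarrow> adj r (x c, x d)) \<and> (case p of (c, d) \<Rightarrow> adj r (x c, x d)) \<le> 1" for p
      using adj_range[of r "(x (fst p), x (snd p))"] code_avg_range[of V r zs "(x (fst p), x (snd p))"]
      by (simp_all add: case_prod_unfold)
    show ?thesis unfolding \<Phi>_def atLeastAtMost_iff
      by (intro conjI mult_nonneg_nonneg prod_nonneg mult_le_one prod_le_1) (simp_all only: A B)
  qed
  let ?B = "block_avg (V \<times> V) (map_prod (code r zs) (code r zs)) (adj r)"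
  have inner: "\<bar>\<Sum>(u, v)\<in>V \<times> V. (adj r (u, v) - ?B (u, v)) * \<Phi> (z(b := v, a := u))\<bar>
      \<le> N\<^sup>2 * sqrt (?E (zs @ map z rs) - ?E zs)" for z
  proof -
    have "\<bar>\<Sum>p\<in>V \<times> V. (adj r p - ?B p) * \<Phi> (z(b := snd p, a := fst p))\<bar>
      \<le> real (card (V \<times> V)) * sqrt (?E (zs @ map z rs) - ?E zs)"
      unfolding code_energy_def
    proof (rule sum_block_diff_le)
      show "finite (V \<times> V)" using V by simp
    next
      fix p q assume "map_prod (code r (zs @ map z rs)) (code r (zs @ map z rs)) p
        = map_prod (code r (zs @ map z rs)) (code r (zs @ map z rs)) q"
      then have eq: "code r (zs @ map z rs) (fst p) = code r (zs @ map z rs) (fst q)"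
        "code r (zs @ map z rs) (snd p) = code r (zs @ map z rs) (snd q)"
        by (simp_all add: map_prod_def case_prod_unfold)
      show "map_prod (code r zs) (code r zs) p = map_prod (code r zs) (code r zs) q"
        using eq[THEN code_append_eqD] by (simp add: map_prod_def case_prod_unfold)
      show "\<Phi> (z(b := snd p, a := fst p)) = \<Phi> (z(b := snd q, a := fst q))"
        by (rule inv) (fact eq)+
    qed (rule \<Phi>_range)
    then show ?thesis by (simp add: N_def card_cartesian_product power2_eq_square case_prod_unfold)
  qed
  have "hybrid_sum V r zs Q s1 (insert (a, b) s2) - hybrid_sum V r zs Q (insert (a, b) s1) s2
      = (\<Sum>x\<in>PiE Q (\<lambda>_. V). (adj r (x a, x b) - ?B (x a, x b)) * \<Phi> x)"
    unfolding hybrid_sum_def \<Phi>_def code_avg_def[symmetric] sum_subtractf[symmetric]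
    using fin s by (intro sum.cong) (simp_all add: algebra_simps)
  also have "\<dots> = (\<Sum>z\<in>PiE R (\<lambda>_. V).
      \<Sum>(u, v)\<in>V \<times> V. (adj r (u, v) - ?B (u, v)) * \<Phi> (z(b := v, a := u)))"
    using ab by (subst Q_eq(1), subst sum_PiE_insert2[OF ab(1) Q_eq(2,3)])
      (intro sum.cong, auto simp: case_prod_unfold)
  also have "\<bar>\<dots>\<bar> \<le> (\<Sum>z\<in>PiE R (\<lambda>_. V). N\<^sup>2 * sqrt (?E (zs @ map z rs) - ?E zs))"
    by (rule order_trans[OF sum_abs]) (rule sum_mono, rule inner)
  also have "\<dots> = N\<^sup>2 * (\<Sum>z\<in>PiE R (\<lambda>_. V). \<bar>sqrt (?E (zs @ map z rs) - ?E zs)\<bar>)"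
    using code_energy_append_ge[OF V(1), of r zs] by (simp add: sum_distrib_left)
  \<comment> \<open>A second Cauchy--Schwarz, now over the images of the other vertices: the mean of
    the square roots is at most the square root of the mean gain, and that mean is the
    \<open>iter_avg\<close> difference.\<close>
  also have "\<dots> \<le> N\<^sup>2 * (real (card (PiE R (\<lambda>_. V))) *
      sqrt ((\<Sum>z\<in>PiE R (\<lambda>_. V). (sqrt (?E (zs @ map z rs) - ?E zs))\<^sup>2) / real (card (PiE R (\<lambda>_. V)))))"
    by (intro mult_left_mono sum_le_sqrt_mean) (use V Q_eq in \<open>auto intro!: finite_PiE\<close>)
  also have "(\<Sum>z\<in>PiE R (\<lambda>_. V). (sqrt (?E (zs @ map z rs) - ?E zs))\<^sup>2)
      = (\<Sum>z\<in>PiE R (\<lambda>_. V). ?E (zs @ map z rs) - ?E zs)"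
    using code_energy_append_ge[OF V(1), of r zs] by (intro sum.cong) auto
  also have "\<dots> = N ^ card R * iter_avg V ?E (card R) zs - N ^ card R * ?E zs"
    using sum_PiE_map_eq_iter_avg[OF V rs(2), of ?E zs] rs(1) len Q_eq(4)
    by (simp add: sum_subtractf card_PiE N_def)
  also have "\<dots> / real (card (PiE R (\<lambda>_. V))) = iter_avg V ?E (card R) zs - ?E zs"
    using N Q_eq(4) by (simp add: card_PiE N_def flip: right_diff_distrib)
  also have "N\<^sup>2 * (real (card (PiE R (\<lambda>_. V))) * sqrt (iter_avg V ?E (card R) zs - ?E zs))
      = N ^ card Q * sqrt (iter_avg V ?E (card Q - 2) zs - ?E zs)"
    using Q_eq(4) unfolding card_Q by (simp add: card_PiE N_def power_add power2_eq_square mult_ac)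
  finally show ?thesis by (simp add: N_def)
qed

text \<open>Moves the edges of \<open>s2\<close> to \<open>s1\<close> one by one. The error of each
  move depends only on \<open>card Q\<close> and \<open>zs\<close>, hence the factor
  \<open>card s2\<close>.\<close>

lemma hybrid_sum_bound:
  assumes V: "finite V" "V \<noteq> {}" and r: "asym r" and Q: "finite Q" and "finite s2"
    and "s1 \<union> s2 \<subseteq> Q \<times> Q" "s1 \<inter> s2 = {}" "asym (s1 \<union> s2)"
  shows "\<bar>hybrid_sum V r zs Q s1 s2 - hybrid_sum V r zs Q (s1 \<union> s2) {}\<bar>
    \<le> real (card s2) * (real (card V) ^ card Q *
      sqrt (iter_avg V (code_energy V r) (card Q - 2) zs - code_energy V r zs))"
  using assms(5-)
proof (induction s2 arbitrary: s1 rule: finite_induct)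
  case (insert p s2)
  obtain a b where p: "p = (a, b)" by force
  let ?d = "real (card V) ^ card Q *
      sqrt (iter_avg V (code_energy V r) (card Q - 2) zs - code_energy V r zs)"
  have "\<bar>hybrid_sum V r zs Q s1 (insert p s2) - hybrid_sum V r zs Q (insert p s1) s2\<bar> \<le> ?d"
    unfolding p by (rule hybrid_sum_step[OF V r Q]) (use insert.prems insert.hyps p in auto)
  moreover have "\<bar>hybrid_sum V r zs Q (insert p s1) s2 - hybrid_sum V r zs Q (insert p s1 \<union> s2) {}\<bar>
      \<le> real (card s2) * ?d"
    by (rule insert.IH) (use insert.prems insert.hyps in auto)
  ultimately show ?case using insert.hyps by (simp add: algebra_simps)
qed simp

section \<open>Frequencies of types and of edges between types\<close>

definition code_freq :: "'a set \<Rightarrow> 'a rel \<Rightarrow> 'a list \<Rightarrow> nat \<Rightarrow> real" where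
  "code_freq V r zs i = real (card {x \<in> V. code r zs x = i}) / real (card V)"

definition code_edge_freq :: "'a set \<Rightarrow> 'a rel \<Rightarrow> 'a list \<Rightarrow> nat \<Rightarrow> nat \<Rightarrow> real" where
  "code_edge_freq V r zs i j =
     real (card {(x, y) \<in> r. code r zs x = i \<and> code r zs y = j}) / (real (card V))\<^sup>2"

text \<open>
  If \<open>a (i p) = 0\<close> then the quotients have the junk value \<open>0\<close>, which is harmless because the product of
  the weights vanishes for \<open>p \<in> Q\<close>.
\<close>

definition step_density :: "nat \<Rightarrow> (nat \<Rightarrow> real) \<Rightarrow> (nat \<Rightarrow> nat \<Rightarrow> real) \<Rightarrow> 'q set \<Rightarrow> 'q rel \<Rightarrow> real" where
  "step_density K a e Q s = (\<Sum>i\<in>PiE Q (\<lambda>_. {..<K}).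
     (\<Prod>q\<in>Q. a (i q)) * (\<Prod>(p, q)\<in>s. e (i p) (i q) / (a (i p) * a (i q))))"

context
  fixes V :: "'a set" and r :: "'a rel" and zs :: "'a list"
  assumes V: "finite V" "V \<noteq> {}" and r: "r \<subseteq> V \<times> V"
begin

lemma card_V_pos: "real (card V) > 0"
  using V by (simp add: card_gt_0_iff)

lemma code_avg_eq:
  assumes "x \<in> V" "y \<in> V"
  shows "code_avg V r zs (x, y) = code_edge_freq V r zs (code r zs x) (code r zs y)
    / (code_freq V r zs (code r zs x) * code_freq V r zs (code r zs y))"
proof -
  let ?C = "\<lambda>x. {x' \<in> V. code r zs x' = code r zs x}"
  have eq: "{p \<in> V \<times> V. map_prod (code r zs) (code r zs) p = map_prod (code r zs) (code r zs) (x, y)}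
      = ?C x \<times> ?C y" by auto
  have "(\<Sum>p\<in>?C x \<times> ?C y. adj r p) = real (card ((?C x \<times> ?C y) \<inter> r))"
    using V by (simp add: adj_def of_bool_def sum.If_cases)
  also have "(?C x \<times> ?C y) \<inter> r = {(x', y') \<in> r. code r zs x' = code r zs x \<and> code r zs y' = code r zs y}"
    using r by auto
  finally show ?thesis using card_V_pos unfolding code_avg_def block_avg_def eq
    by (simp add: code_edge_freq_def code_freq_def card_cartesian_product power2_eq_square)
qed

text \<open>Groups the assignments by their vector of types. The fibre over \<open>i\<close> is a
  product of type classes, so its size is the product of theirs.\<close>

lemma sum_PiE_code:
  assumes "finite Q"
  shows "(\<Sum>x\<in>PiE Q (\<lambda>_. V). F (restrict (\<lambda>q. code r zs (x q)) Q))
    = real (card V) ^ card Q * (\<Sum>i\<in>PiE Q (\<lambda>_. {..<3 ^ length zs}). (\<Prod>q\<in>Q. code_freq V r zs (i q)) * F i)"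
proof -
  let ?h = "\<lambda>x. restrict (\<lambda>q. code r zs (x q)) Q" and ?T = "PiE Q (\<lambda>_. {..<(3::nat) ^ length zs})"
  have fin: "finite ?T" "finite (PiE Q (\<lambda>_. V))" using assms V by (auto intro!: finite_PiE)
  have "(\<Sum>x\<in>PiE Q (\<lambda>_. V). F (?h x)) = (\<Sum>i\<in>?T. \<Sum>x\<in>{x \<in> PiE Q (\<lambda>_. V). ?h x = i}. F (?h x))"
    by (rule sum.group[symmetric]) (use fin in \<open>auto simp: code_less\<close>)
  also have "\<dots> = (\<Sum>i\<in>?T. real (card V) ^ card Q * ((\<Prod>q\<in>Q. code_freq V r zs (i q)) * F i))"
  proof (rule sum.cong[OF refl])
    fix i assume i: "i \<in> ?T"
    have eq: "{x \<in> PiE Q (\<lambda>_. V). ?h x = i} = PiE Q (\<lambda>q. {x \<in> V. code r zs x = i q})"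
    proof (intro set_eqI iffI)
      fix x assume "x \<in> {x \<in> PiE Q (\<lambda>_. V). ?h x = i}"
      then show "x \<in> PiE Q (\<lambda>q. {x \<in> V. code r zs x = i q})"
        by (auto simp: PiE_def Pi_def)
    next
      fix x assume x: "x \<in> PiE Q (\<lambda>q. {x \<in> V. code r zs x = i q})"
      then have "?h x = i" using i by (intro ext) (auto simp: PiE_def extensional_def Pi_def)
      then show "x \<in> {x \<in> PiE Q (\<lambda>_. V). ?h x = i}" using x by (auto simp: PiE_def Pi_def)
    qed
    have "(\<Sum>x\<in>{x \<in> PiE Q (\<lambda>_. V). ?h x = i}. F (?h x)) = (\<Sum>x\<in>{x \<in> PiE Q (\<lambda>_. V). ?h x = i}. F i)"
      by (rule sum.cong) auto
    also have "\<dots> = real (\<Prod>q\<in>Q. card {x \<in> V. code r zs x = i q}) * F i"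
      unfolding eq using assms by (simp add: card_PiE)
    also have "\<dots> = real (card V) ^ card Q * ((\<Prod>q\<in>Q. code_freq V r zs (i q)) * F i)"
      using card_V_pos by (simp add: code_freq_def prod_dividef)
    finally show "(\<Sum>x\<in>{x \<in> PiE Q (\<lambda>_. V). ?h x = i}. F (?h x))
      = real (card V) ^ card Q * ((\<Prod>q\<in>Q. code_freq V r zs (i q)) * F i)" .
  qed
  finally show ?thesis by (simp add: sum_distrib_left)
qed

lemma hybrid_sum_left:
  assumes "finite Q" "s \<subseteq> Q \<times> Q"
  shows "hybrid_sum V r zs Q s {} = real (card V) ^ card Q *
    step_density (3 ^ length zs) (code_freq V r zs) (code_edge_freq V r zs) Q s"
proof -
  let ?h = "\<lambda>x. restrict (\<lambda>q. code r zs (x q)) Q"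
  let ?F = "\<lambda>i. \<Prod>(p, q)\<in>s. code_edge_freq V r zs (i p) (i q) / (code_freq V r zs (i p) * code_freq V r zs (i q))"
  have "(\<Prod>(p, q)\<in>s. code_avg V r zs (x p, x q)) = ?F (?h x)" if x: "x \<in> PiE Q (\<lambda>_. V)" for x
  proof (rule prod.cong[OF refl])
    fix e assume "e \<in> s"
    then obtain p q where e: "e = (p, q)" "p \<in> Q" "q \<in> Q" using assms by auto
    then have "x p \<in> V" "x q \<in> V" using x by (auto simp: PiE_def Pi_def)
    then show "(case e of (p, q) \<Rightarrow> code_avg V r zs (x p, x q)) = (case e of (p, q) \<Rightarrow>
        code_edge_freq V r zs (?h x p) (?h x q) / (code_freq V r zs (?h x p) * code_freq V r zs (?h x q)))"
      using e by (simp add: code_avg_eq)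
  qed
  then have "hybrid_sum V r zs Q s {} = (\<Sum>x\<in>PiE Q (\<lambda>_. V). ?F (?h x))"
    unfolding hybrid_sum_def by (intro sum.cong) simp_all
  then show ?thesis using sum_PiE_code[OF assms(1), of ?F] by (simp add: step_density_def)
qed

lemma hybrid_sum_right:
  assumes "finite Q" "s \<subseteq> Q \<times> Q"
  shows "hybrid_sum V r zs Q {} s = real (card V) ^ card Q * poset_density Q s V r"
proof -
  have fin: "finite s" using assms by (auto intro: finite_subset)
  have *: "(\<Prod>(a, b)\<in>s. adj r (x a, x b)) = of_bool (\<forall>a\<in>Q. \<forall>b\<in>Q. (a, b) \<in> s \<longrightarrow> (x a, x b) \<in> r)" for x
  proof (cases "\<forall>(a, b)\<in>s. (x a, x b) \<in> r")
    case True
    then have "(\<Prod>(a, b)\<in>s. adj r (x a, x b)) = 1" by (intro prod.neutral) (auto simp: adj_def)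
    then show ?thesis using True by auto
  next
    case False
    then obtain p where p: "p \<in> s" "(x (fst p), x (snd p)) \<notin> r" by auto
    then have "(\<Prod>(a, b)\<in>s. adj r (x a, x b)) = 0"
      by (intro prod_zero[OF fin] bexI[of _ p]) (simp_all add: adj_def case_prod_unfold)
    moreover have "\<not> (\<forall>a\<in>Q. \<forall>b\<in>Q. (a, b) \<in> s \<longrightarrow> (x a, x b) \<in> r)" using False assms by auto
    ultimately show ?thesis by simp
  qed
  have "hybrid_sum V r zs Q {} s = (\<Sum>x\<in>PiE Q (\<lambda>_. V). of_bool (\<forall>a\<in>Q. \<forall>b\<in>Q. (a, b) \<in> s \<longrightarrow> (x a, x b) \<in> r))"
    by (simp add: hybrid_sum_def *)
  also have "\<dots> = real (card (poset_homs Q s V r))"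
    using assms V by (simp add: poset_homs_def finite_PiE Int_def of_bool_def sum.If_cases)
  finally show ?thesis using assms card_V_pos by (simp add: poset_density_def card_PiE)
qed

text \<open>The two ends of the hybrid interpolation, normalised. It is stated for asymmetric
  \<open>s\<close> so that it also covers the path on three points, whose relation is not
  transitive.\<close>

lemma poset_density_step_density_diff:
  assumes "asym r" "finite Q" "s \<subseteq> Q \<times> Q" "asym s"
  shows "\<bar>poset_density Q s V r -
      step_density (3 ^ length zs) (code_freq V r zs) (code_edge_freq V r zs) Q s\<bar>
    \<le> real (card s) * sqrt (iter_avg V (code_energy V r) (card Q - 2) zs - code_energy V r zs)"
    (is "\<bar>?t - ?T\<bar> \<le> _ * ?e")
proof -
  have "finite s" using assms by (auto intro: finite_subset)
  from hybrid_sum_bound[OF V assms(1,2) this, of "{}" zs]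
  have "\<bar>real (card V) ^ card Q * ?t - real (card V) ^ card Q * ?T\<bar>
      \<le> real (card s) * (real (card V) ^ card Q * ?e)"
    using assms by (simp add: hybrid_sum_left hybrid_sum_right)
  also have "\<bar>real (card V) ^ card Q * ?t - real (card V) ^ card Q * ?T\<bar>
      = real (card V) ^ card Q * \<bar>?t - ?T\<bar>"
    by (simp add: abs_mult flip: right_diff_distrib)
  finally show ?thesis using card_V_pos by (simp add: mult.left_commute)
qed

lemma code_freq_range: "code_freq V r zs i \<in> {0..1}"
  using V by (auto simp: code_freq_def divide_le_eq_1 card_gt_0_iff intro!: card_mono)

lemma code_freq_0: "zs = [] \<Longrightarrow> code_freq V r zs 0 = 1"
  using card_V_pos by (simp add: code_freq_def)

lemma code_freq_eq_0: "i \<ge> 3 ^ length zs \<Longrightarrow> code_freq V r zs i = 0"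
proof -
  assume "i \<ge> 3 ^ length zs"
  then have "{x \<in> V. code r zs x = i} = {}" using code_less[of r zs] by (force simp: not_le[symmetric])
  then show ?thesis by (simp only: code_freq_def) simp
qed

lemma code_snoc_eq_iff:
  "d < 3 \<Longrightarrow> code r (zs @ [z]) x = 3 * i + d \<longleftrightarrow> code r zs x = i \<and> digit r z x = d"
  using base3_eq_iff[OF digit_less] by (simp add: code_snoc)

lemma code_freq_split: "code_freq V r zs i = (\<Sum>d<3. code_freq V r (zs @ [z]) (3 * i + d))"
proof -
  have "card (\<Union>d\<in>{..<3}. {x \<in> V. code r (zs @ [z]) x = 3 * i + d})
      = (\<Sum>d<3. card {x \<in> V. code r (zs @ [z]) x = 3 * i + d})"
  proof (intro card_UN_disjoint ballI impI)
    fix c d :: nat assume "c \<in> {..<3}" "d \<in> {..<3}" "c \<noteq> d"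
    then show "{x \<in> V. code r (zs @ [z]) x = 3 * i + c} \<inter> {x \<in> V. code r (zs @ [z]) x = 3 * i + d} = {}"
      by auto
  qed (use V in auto)
  also have "(\<Union>d\<in>{..<3}. {x \<in> V. code r (zs @ [z]) x = 3 * i + d}) = {x \<in> V. code r zs x = i}"
    using digit_less[of r z] by (auto simp: code_snoc_eq_iff)
  finally show ?thesis by (simp add: code_freq_def flip: sum_divide_distrib)
qed

lemma code_edge_freq_split:
  "code_edge_freq V r zs i j
    = (\<Sum>(c, d)\<in>{..<3} \<times> {..<3}. code_edge_freq V r (zs @ [z]) (3 * i + c) (3 * j + d))"
proof -
  let ?E = "\<lambda>p. {(x, y) \<in> r. code r (zs @ [z]) x = 3 * i + fst p \<and> code r (zs @ [z]) y = 3 * j + snd p}"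
  have fin: "finite r" using V r by (auto intro: finite_subset)
  have "card (\<Union>p\<in>{..<3} \<times> {..<3}. ?E p) = (\<Sum>p\<in>{..<3} \<times> {..<3}. card (?E p))"
  proof (intro card_UN_disjoint ballI impI)
    fix p :: "nat \<times> nat"
    show "finite (?E p)" using fin by (rule rev_finite_subset) auto
  next
    fix p q :: "nat \<times> nat" assume "p \<noteq> q"
    then show "?E p \<inter> ?E q = {}" by (auto simp: prod_eq_iff)
  qed simp
  also have "(\<Union>p\<in>{..<3} \<times> {..<3}. ?E p) = {(x, y) \<in> r. code r zs x = i \<and> code r zs y = j}"
  proof (intro set_eqI iffI)
    fix e assume "e \<in> (\<Union>p\<in>{..<3} \<times> {..<3}. ?E p)"
    then show "e \<in> {(x, y) \<in> r. code r zs x = i \<and> code r zs y = j}"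
      by (auto simp: code_snoc_eq_iff)
  next
    fix e assume e: "e \<in> {(x, y) \<in> r. code r zs x = i \<and> code r zs y = j}"
    then have "e \<in> ?E (digit r z (fst e), digit r z (snd e))"
      by (auto simp: code_snoc)
    then show "e \<in> (\<Union>p\<in>{..<3} \<times> {..<3}. ?E p)"
      using digit_less[of r z] by (intro UN_I[of "(digit r z (fst e), digit r z (snd e))"]) auto
  qed
  finally show ?thesis
    by (simp add: code_edge_freq_def case_prod_unfold flip: sum_divide_distrib)
qed

lemma code_edge_freq_le: "code_edge_freq V r zs i j \<le> code_freq V r zs i * code_freq V r zs j"
proof -
  have "card {(x, y) \<in> r. code r zs x = i \<and> code r zs y = j}
      \<le> card ({x \<in> V. code r zs x = i} \<times> {x \<in> V. code r zs x = j})"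
    using V r by (intro card_mono) auto
  then have "real (card {(x, y) \<in> r. code r zs x = i \<and> code r zs y = j})
      \<le> real (card {x \<in> V. code r zs x = i} * card {x \<in> V. code r zs x = j})"
    by (simp only: card_cartesian_product of_nat_le_iff)
  then show ?thesis using card_V_pos
    by (simp add: code_edge_freq_def code_freq_def power2_eq_square divide_right_mono)
qed

text \<open>An edge never decreases the code, so no edge leads from a larger to a smaller one. This
  is what places the limit kernel above the diagonal.\<close>

lemma code_edge_freq_order: "trans r \<Longrightarrow> j < i \<Longrightarrow> code_edge_freq V r zs i j = 0"
proof -
  assume "trans r" "j < i"
  then have "{(x, y) \<in> r. code r zs x = i \<and> code r zs y = j} = {}"
    using code_mono[of r _ _ zs] by (force simp: not_le[symmetric])
  then show ?thesis by (simp only: code_edge_freq_def) simp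
qed

text \<open>The edges inside a class and their reversals are disjoint subsets of the square of the
  class. In the limit this keeps the step kernels at most 1/2 on diagonal blocks.\<close>

lemma code_edge_freq_diag:
  assumes "asym r"
  shows "2 * code_edge_freq V r zs i i \<le> (code_freq V r zs i)\<^sup>2"
proof -
  let ?E = "{(x, y) \<in> r. code r zs x = i \<and> code r zs y = i}" and ?C = "{x \<in> V. code r zs x = i}"
  have fin: "finite ?E" using V r by (auto intro: finite_subset[of _ "V \<times> V"])
  have "2 * card ?E = card ?E + card (?E\<inverse>)" by (simp add: card_inverse del: converse_iff)
  also have "\<dots> = card (?E \<union> ?E\<inverse>)"
    using fin assms by (intro card_Un_disjoint[symmetric]) (auto dest: asymD)
  also have "\<dots> \<le> card (?C \<times> ?C)" using V r by (intro card_mono) auto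
  finally have "real (2 * card ?E) \<le> real (card ?C * card ?C)"
    by (simp only: card_cartesian_product of_nat_le_iff)
  then show ?thesis using card_V_pos
    by (simp add: code_edge_freq_def code_freq_def power2_eq_square divide_right_mono)
qed

end

section \<open>Choosing the reference list\<close>

text \<open>Telescoping with shift \<open>k\<close>: the sum reduces to \<open>k\<close> differences
  of values in the unit interval, whatever the length \<open>n\<close>.\<close>

lemma sum_shift_diff_le:
  fixes f :: "nat \<Rightarrow> real"
  assumes "\<And>m. f m \<in> {0..1}"
  shows "(\<Sum>m<n. f (m + k) - f m) \<le> real k"
proof -
  have "(\<Sum>m<n. f (m + k) - f m) = (\<Sum>m<k. f (n + m) - f m)"
  proof (induction k)
    case (Suc k)
    have "(\<Sum>m<n. f (m + Suc k) - f m) = (\<Sum>m<n. f (m + k) - f m) + (\<Sum>m<n. f (Suc m + k) - f (m + k))"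
      by (simp flip: sum.distrib)
    also have "(\<Sum>m<n. f (Suc m + k) - f (m + k)) = f (n + k) - f k"
      using sum_lessThan_telescope[of "\<lambda>m. f (m + k)" n] by simp
    finally show ?case using Suc by simp
  qed simp
  also have "\<dots> \<le> (\<Sum>m<k. 1)"
  proof (rule sum_mono)
    fix m show "f (n + m) - f m \<le> 1" using assms[of "n + m"] assms[of m] by auto
  qed
  finally show ?thesis by simp
qed

text \<open>With \<open>f m\<close> the expected energy after m random points, the expected gain at
  level m from k further points is \<open>f (m + k) - f m\<close>, so these gains sum to at most k
  over the levels. The weighted total over all k is at most 2 in expectation; some list attains
  this, and dividing by the weight of k gives the bound \<open>2 * 2 ^ k\<close>.\<close>

lemma exists_reference_list:
  assumes V: "finite V" "V \<noteq> {}"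
  shows "\<exists>zs. set zs \<subseteq> V \<and> length zs = n \<and> (\<forall>k<n.
    (\<Sum>m<n. iter_avg V (code_energy V r) k (take m zs) - code_energy V r (take m zs)) \<le> 2 * 2 ^ k)"
proof -
  let ?E = "code_energy V r"
  \<comment> \<open>The weights only have to keep the sum of \<open>(1/2) ^ k * k\<close> bounded;
    all terms are nonnegative, so a bound on \<open>h\<close> bounds each gain separately.\<close>
  define h where "h = (\<lambda>zs. \<Sum>k<n. (1/2) ^ k * (iter_avg V ?E k zs - ?E zs))"
  have range: "iter_avg V ?E k zs \<in> {0..1}" for k zs
    by (rule iter_avg_range) (rule code_energy_range)
  have ge: "?E zs \<le> iter_avg V ?E k zs" for k zs
    by (rule iter_avg_ge[OF V]) (rule code_energy_append_ge[OF V(1)])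
  from exists_list_sum_le_iter_avg[OF V, of n h "[]"]
  obtain zs where zs: "set zs \<subseteq> V" "length zs = n"
    "(\<Sum>m<n. h (take m zs)) \<le> (\<Sum>m<n. iter_avg V h m [])" by auto
  have geo: "(\<Sum>k<n. (1/2) ^ k * real k) = 2 - (real n + 1) * (1/2) ^ n * 2" for n
    by (induction n) (simp_all add: algebra_simps add_divide_distrib)
  have "(\<Sum>m<n. iter_avg V h m []) = (\<Sum>m<n. \<Sum>k<n. (1/2) ^ k * (iter_avg V ?E (m + k) [] - iter_avg V ?E m []))"
    unfolding h_def by (simp only: iter_avg_sum iter_avg_diff iter_avg_add)
  also have "\<dots> = (\<Sum>k<n. (1/2) ^ k * (\<Sum>m<n. iter_avg V ?E (m + k) [] - iter_avg V ?E m []))"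
    by (subst sum.swap) (simp add: sum_distrib_left)
  also have "\<dots> \<le> (\<Sum>k<n. (1/2) ^ k * real k)"
    by (intro sum_mono mult_left_mono sum_shift_diff_le range) auto
  also have "\<dots> \<le> 2" unfolding geo by simp
  finally have bound: "(\<Sum>m<n. h (take m zs)) \<le> 2" using zs(3) by simp
  have "(\<Sum>m<n. iter_avg V ?E k (take m zs) - ?E (take m zs)) \<le> 2 * 2 ^ k" if k: "k < n" for k
  proof -
    have "(1/2) ^ k * (\<Sum>m<n. iter_avg V ?E k (take m zs) - ?E (take m zs))
        = (\<Sum>m<n. (1/2) ^ k * (iter_avg V ?E k (take m zs) - ?E (take m zs)))"
      by (simp add: sum_distrib_left)
    also have "\<dots> \<le> (\<Sum>m<n. h (take m zs))"
    proof (rule sum_mono)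
      fix m
      show "(1/2) ^ k * (iter_avg V ?E k (take m zs) - ?E (take m zs)) \<le> h (take m zs)"
        unfolding h_def using k ge
        by (intro member_le_sum[of k "{..<n}" "\<lambda>k. (1/2) ^ k * (iter_avg V ?E k (take m zs) - ?E (take m zs))"]) auto
    qed
    also note bound
    finally show ?thesis by (simp add: power_one_over divide_simps)
  qed
  then show ?thesis using zs by blast
qed

section \<open>Passing to the limit of the type frequencies\<close>

text \<open>The quotients are discontinuous where a weight tends to 0. In that case they stay in the
  unit interval by \<open>bounds\<close>, while the product of the weights in front tends to
  0.\<close>

lemma step_density_tendsto:
  fixes a' :: "nat \<Rightarrow> nat \<Rightarrow> real" and e' :: "nat \<Rightarrow> nat \<Rightarrow> nat \<Rightarrow> real"
  assumes a: "\<And>i. (\<lambda>n. a' n i) \<longlonglongrightarrow> a i" and e: "\<And>i j. (\<lambda>n. e' n i j) \<longlonglongrightarrow> e i j"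
    and bounds: "\<forall>\<^sub>F n in sequentially. \<forall>i j. 0 \<le> a' n i \<and> 0 \<le> e' n i j \<and> e' n i j \<le> a' n i * a' n j"
    and Q: "finite Q" "s \<subseteq> Q \<times> Q"
  shows "(\<lambda>n. step_density K (a' n) (e' n) Q s) \<longlonglongrightarrow> step_density K a e Q s"
  unfolding step_density_def
proof (rule tendsto_sum)
  fix i assume "i \<in> PiE Q (\<lambda>_. {..<K})"
  show "(\<lambda>n. (\<Prod>q\<in>Q. a' n (i q)) * (\<Prod>(p, q)\<in>s. e' n (i p) (i q) / (a' n (i p) * a' n (i q))))
    \<longlonglongrightarrow> (\<Prod>q\<in>Q. a (i q)) * (\<Prod>(p, q)\<in>s. e (i p) (i q) / (a (i p) * a (i q)))"
  proof (cases "\<forall>q\<in>Q. a (i q) \<noteq> 0")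
    case True
    show ?thesis unfolding case_prod_unfold
      using True Q by (intro tendsto_intros a e) auto
  next
    case False
    then have 0: "(\<Prod>q\<in>Q. a (i q)) = 0" using Q by auto
    have "(\<lambda>n. (\<Prod>q\<in>Q. a' n (i q))) \<longlonglongrightarrow> 0" unfolding 0[symmetric] by (intro tendsto_intros a)
    moreover have "\<forall>\<^sub>F n in sequentially. norm ((\<Prod>q\<in>Q. a' n (i q)) *
        (\<Prod>(p, q)\<in>s. e' n (i p) (i q) / (a' n (i p) * a' n (i q)))) \<le> (\<Prod>q\<in>Q. a' n (i q))"
      using bounds
    proof eventually_elim
      case (elim n)
      have "0 \<le> (\<Prod>q\<in>Q. a' n (i q))" using elim by (intro prod_nonneg) auto
      moreover have "0 \<le> (\<Prod>(p, q)\<in>s. e' n (i p) (i q) / (a' n (i p) * a' n (i q)))"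
        using elim by (intro prod_nonneg) auto
      moreover have "(\<Prod>(p, q)\<in>s. e' n (i p) (i q) / (a' n (i p) * a' n (i q))) \<le> 1"
        using elim by (intro prod_le_1) (auto intro: divide_le_eq_1 simp: divide_le_eq_1 less_le)
      ultimately show ?case by (simp add: abs_mult mult_left_le)
    qed
    ultimately have "(\<lambda>n. (\<Prod>q\<in>Q. a' n (i q)) * (\<Prod>(p, q)\<in>s. e' n (i p) (i q) / (a' n (i p) * a' n (i q))))
        \<longlonglongrightarrow> 0"
      by (rule Lim_null_comparison[rotated])
    then show ?thesis by (simp add: 0)
  qed
qed

text \<open>Sequential compactness of a countable power of the unit interval, in the role of a
  diagonal extraction.\<close>

lemma countable_family_convergent_subseq:
  fixes F :: "nat \<Rightarrow> 'i :: countable \<Rightarrow> real"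
  assumes "\<And>n i. F n i \<in> {0..1}"
  obtains \<phi> l where "strict_mono \<phi>" "\<And>i. (\<lambda>n. F (\<phi> n) i) \<longlonglongrightarrow> l i"
proof -
  have "compactin (product_topology (\<lambda>i::'i. euclidean) UNIV) (PiE UNIV (\<lambda>_. {0..1::real}))"
    unfolding compactin_PiE by simp
  then have "compact (PiE UNIV (\<lambda>_::'i. {0..1::real}))"
    by (simp only: euclidean_product_topology compactin_euclidean_iff)
  then have "seq_compact (PiE UNIV (\<lambda>_::'i. {0..1::real}))"
    by (rule compact_imp_seq_compact)
  moreover have "\<forall>n. F n \<in> PiE UNIV (\<lambda>_. {0..1})" using assms by (auto simp: PiE_UNIV_domain)
  ultimately obtain l \<phi> where "strict_mono \<phi>" "(F \<circ> \<phi>) \<longlonglongrightarrow> l"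
    by (auto elim!: seq_compactE)
  moreover have "continuous_on UNIV (\<lambda>f::'i \<Rightarrow> real. f i)" for i
    by (rule continuous_on_product_coordinates)
  then have "isCont (\<lambda>f::'i \<Rightarrow> real. f i) l" for i
    by (simp add: continuous_on_eq_continuous_within)
  ultimately show ?thesis using that[of \<phi> l] isCont_tendsto_compose
    by (fastforce simp: o_def)
qed

text \<open>
  \<open>a m i\<close> and \<open>e m i j\<close> are the limiting frequencies of the type with code \<open>i\<close> and of the edges from
  type \<open>i\<close> to type \<open>j\<close> with respect to the first \<open>m\<close> reference points; the types refining \<open>i\<close> at level
  \<open>Suc m\<close> have codes \<open>3 * i\<close>, \<open>3 * i + 1\<close> and \<open>3 * i + 2\<close>.
\<close>

locale edge_limit =
  fixes a :: "nat \<Rightarrow> nat \<Rightarrow> real" and e :: "nat \<Rightarrow> nat \<Rightarrow> nat \<Rightarrow> real"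
  assumes a_nonneg: "0 \<le> a m i"
    and a_root: "a 0 0 = 1"
    and a_eq_0: "3 ^ m \<le> i \<Longrightarrow> a m i = 0"
    and a_split: "a m i = (\<Sum>d<3. a (Suc m) (3 * i + d))"
    and e_nonneg: "0 \<le> e m i j"
    and e_le: "e m i j \<le> a m i * a m j"
    and e_split: "e m i j = (\<Sum>(c, d)\<in>{..<3} \<times> {..<3}. e (Suc m) (3 * i + c) (3 * j + d))"
    and e_order: "j < i \<Longrightarrow> e m i j = 0"
    and e_diag: "2 * e m i i \<le> (a m i)\<^sup>2"

text \<open>The n-th poset gets a list of n points, and level m uses its first m. For fixed m the
  frequencies converge along a subsequence; the squared errors summed over the levels have a bound
  independent of n, which passes to the limit.\<close>

lemma poset_sequence_edge_limit:
  fixes P :: "nat \<Rightarrow> 'a set" and r :: "nat \<Rightarrow> 'a rel"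
  assumes poset: "\<And>n. finite_poset (P n) (r n)"
    and inf: "filterlim (\<lambda>n. card (P n)) at_top sequentially"
  shows "\<exists>a e. edge_limit a e \<and> (\<forall>(Q :: nat set) s t. finite Q \<and> s \<subseteq> Q \<times> Q \<and> asym s \<and>
      (\<lambda>n. poset_density Q s (P n) (r n)) \<longlonglongrightarrow> t \<longrightarrow>
      (\<lambda>m. step_density (3 ^ m) (a m) (e m) Q s) \<longlonglongrightarrow> t)"
proof -
  have fin: "finite (P n)" and sub: "r n \<subseteq> P n \<times> P n" and tr: "trans (r n)" and asym: "asym (r n)" for n
    using poset[of n] by (auto simp: finite_poset_def irrefl_def intro!: asymI dest: transD)
  let ?E = "\<lambda>n. code_energy (P n) (r n)"
  \<comment> \<open>Finitely many of the posets may be empty and then offer no reference points;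
    this guard is discharged later by "eventually".\<close>
  have "\<forall>n. \<exists>z. P n \<noteq> {} \<longrightarrow> length z = n \<and>
      (\<forall>k<n. (\<Sum>m<n. iter_avg (P n) (?E n) k (take m z) - ?E n (take m z)) \<le> 2 * 2 ^ k)"
    using exists_reference_list[OF fin] by blast
  from choice[OF this] obtain z where z': "\<forall>n. P n \<noteq> {} \<longrightarrow> length (z n) = n \<and>
      (\<forall>k<n. (\<Sum>m<n. iter_avg (P n) (?E n) k (take m (z n)) - ?E n (take m (z n))) \<le> 2 * 2 ^ k)"
    by blast
  have z: "P n \<noteq> {} \<Longrightarrow> length (z n) = n"
    "P n \<noteq> {} \<Longrightarrow> k < n \<Longrightarrow>
      (\<Sum>m<n. iter_avg (P n) (?E n) k (take m (z n)) - ?E n (take m (z n))) \<le> 2 * 2 ^ k" for n k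
    using z' by blast+
  define a' where "a' = (\<lambda>n m i. code_freq (P n) (r n) (take m (z n)) i)"
  define e' where "e' = (\<lambda>n m i j. code_edge_freq (P n) (r n) (take m (z n)) i j)"
  have a'_range: "a' n m i \<in> {0..1}" for n m i
    using code_freq_range[OF fin _ sub, of n] by (cases "P n = {}") (auto simp: a'_def code_freq_def)
  have e'_nonneg: "e' n m i j \<ge> 0" for n m i j
    by (simp add: e'_def code_edge_freq_def)
  have e'_le: "e' n m i j \<le> a' n m i * a' n m j" for n m i j
    using code_edge_freq_le[OF fin _ sub, of n]
    by (cases "P n = {}") (auto simp: a'_def e'_def code_freq_def code_edge_freq_def)
  have e'_le_1: "e' n m i j \<le> 1" for n m i j
    using e'_le[of n m i j] a'_range[of n m i] a'_range[of n m j]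
    by (auto intro: order_trans mult_le_one)
  \<comment> \<open>All statistics of all levels form one family over a countable index type, so a
    single subsequence serves them all.\<close>
  define F where "F = (\<lambda>n. case_sum (\<lambda>(m, i). a' n m i) (\<lambda>(m, i, j). e' n m i j))"
  have "F n x \<in> {0..1}" for n x
    using a'_range e'_nonneg e'_le_1 by (cases x) (auto simp: F_def)
  then obtain \<phi> l where \<phi>: "strict_mono \<phi>" and l: "\<And>x. (\<lambda>n. F (\<phi> n) x) \<longlonglongrightarrow> l x"
    using countable_family_convergent_subseq[of F] by metis
  define a where "a = (\<lambda>m i. l (Inl (m, i)))"
  define e where "e = (\<lambda>m i j. l (Inr (m, i, j)))"
  have lim_a: "(\<lambda>n. a' (\<phi> n) m i) \<longlonglongrightarrow> a m i" for m i
    using l[of "Inl (m, i)"] by (simp add: F_def a_def)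
  have lim_e: "(\<lambda>n. e' (\<phi> n) m i j) \<longlonglongrightarrow> e m i j" for m i j
    using l[of "Inr (m, i, j)"] by (simp add: F_def e_def)
  have \<phi>_top: "filterlim \<phi> at_top sequentially" by (rule filterlim_subseq[OF \<phi>])
  have "\<forall>\<^sub>F n in sequentially. card (P n) \<ge> 1"
    using inf by (simp add: filterlim_at_top)
  then have "\<forall>\<^sub>F n in sequentially. P n \<noteq> {}"
    by eventually_elim auto
  then have ev: "\<forall>\<^sub>F n in sequentially. P (\<phi> n) \<noteq> {} \<and> m < \<phi> n" for m
    using \<phi>_top by (intro eventually_conj)
      (auto intro: eventually_compose_filterlim[OF _ \<phi>_top] simp: filterlim_at_top_dense)
  have take_Suc: "take (Suc m) (z n) = take m (z n) @ [z n ! m]" if "P n \<noteq> {}" "m < n" for m n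
    using that z(1) by (simp add: take_Suc_conv_app_nth)
  have "edge_limit a e"
  proof
    fix m i j
    show "0 \<le> a m i"
      by (rule tendsto_lowerbound[OF lim_a]) (use a'_range in auto)
    show "0 \<le> e m i j"
      by (rule tendsto_lowerbound[OF lim_e]) (use e'_nonneg in auto)
    show "e m i j \<le> a m i * a m j"
      by (rule tendsto_le[OF _ tendsto_mult[OF lim_a lim_a] lim_e]) (use e'_le in auto)
    have "\<forall>\<^sub>F n in sequentially. a' (\<phi> n) 0 0 = 1"
      using ev[of 0] by eventually_elim (auto simp: a'_def intro!: code_freq_0 fin sub)
    from tendsto_eventually[OF this] show "a 0 0 = 1" using lim_a LIMSEQ_unique by blast
    show "a m i = (\<Sum>d<3. a (Suc m) (3 * i + d))"
    proof (rule LIMSEQ_unique[OF lim_a])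
      have "(\<lambda>n. \<Sum>d<3. a' (\<phi> n) (Suc m) (3 * i + d)) \<longlonglongrightarrow> (\<Sum>d<3. a (Suc m) (3 * i + d))"
        by (intro tendsto_sum lim_a)
      moreover have "\<forall>\<^sub>F n in sequentially. a' (\<phi> n) m i = (\<Sum>d<3. a' (\<phi> n) (Suc m) (3 * i + d))"
        using ev[of m]
        by eventually_elim (simp add: a'_def take_Suc code_freq_split[OF fin _ sub, symmetric])
      ultimately show "(\<lambda>n. a' (\<phi> n) m i) \<longlonglongrightarrow> (\<Sum>d<3. a (Suc m) (3 * i + d))"
        by (simp add: tendsto_cong)
    qed
    show "e m i j = (\<Sum>(c, d)\<in>{..<3} \<times> {..<3}. e (Suc m) (3 * i + c) (3 * j + d))"
    proof (rule LIMSEQ_unique[OF lim_e])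
      have "(\<lambda>n. \<Sum>(c, d)\<in>{..<3} \<times> {..<3}. e' (\<phi> n) (Suc m) (3 * i + c) (3 * j + d))
          \<longlonglongrightarrow> (\<Sum>(c, d)\<in>{..<3} \<times> {..<3}. e (Suc m) (3 * i + c) (3 * j + d))"
        unfolding case_prod_unfold by (intro tendsto_sum lim_e)
      moreover have "\<forall>\<^sub>F n in sequentially. e' (\<phi> n) m i j
          = (\<Sum>(c, d)\<in>{..<3} \<times> {..<3}. e' (\<phi> n) (Suc m) (3 * i + c) (3 * j + d))"
        using ev[of m]
        by eventually_elim (simp add: e'_def take_Suc code_edge_freq_split[OF fin _ sub, symmetric])
      ultimately show "(\<lambda>n. e' (\<phi> n) m i j) \<longlonglongrightarrow>
          (\<Sum>(c, d)\<in>{..<3} \<times> {..<3}. e (Suc m) (3 * i + c) (3 * j + d))"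
        by (simp add: tendsto_cong)
    qed
    show "2 * e m i i \<le> (a m i)\<^sup>2"
    proof (rule tendsto_le[OF _ tendsto_power[OF lim_a] tendsto_mult[OF tendsto_const lim_e]])
      show "\<forall>\<^sub>F n in sequentially. 2 * e' (\<phi> n) m i i \<le> (a' (\<phi> n) m i)\<^sup>2"
        using ev[of m]
        by eventually_elim (auto simp: a'_def e'_def intro!: code_edge_freq_diag fin sub asym)
    qed simp
  next
    fix m i :: nat assume i: "3 ^ m \<le> i"
    have "\<forall>\<^sub>F n in sequentially. a' (\<phi> n) m i = 0"
      using ev[of m]
    proof eventually_elim
      case (elim n)
      then have "length (take m (z (\<phi> n))) = m" using z(1)[of "\<phi> n"] by simp
      then show ?case using elim i unfolding a'_def
        by (intro code_freq_eq_0 fin sub) simp_all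
    qed
    from tendsto_eventually[OF this] show "a m i = 0" using lim_a LIMSEQ_unique by blast
  next
    fix m i j :: nat assume ij: "j < i"
    have "\<forall>\<^sub>F n in sequentially. e' (\<phi> n) m i j = 0"
      using ev[of m] by eventually_elim
        (use ij in \<open>auto simp: e'_def intro!: code_edge_freq_order fin sub tr\<close>)
    from tendsto_eventually[OF this] show "e m i j = 0" using lim_e LIMSEQ_unique by blast
  qed
  moreover have "(\<lambda>m. step_density (3 ^ m) (a m) (e m) Q s) \<longlonglongrightarrow> t"
    if Q: "finite Q" "s \<subseteq> Q \<times> Q" "asym s" and t: "(\<lambda>n. poset_density Q s (P n) (r n)) \<longlonglongrightarrow> t"
    for Q :: "nat set" and s t
  proof -
    define T where "T = (\<lambda>m. step_density (3 ^ m) (a m) (e m) Q s)"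
    define T' where "T' = (\<lambda>n m. step_density (3 ^ m) (a' n m) (e' n m) Q s)"
    define t' where "t' = (\<lambda>n. poset_density Q s (P n) (r n))"
    \<comment> \<open>The number of vertices other than the two ends of a replaced edge; truncation
      at 0 is harmless, since a nonempty asymmetric \<open>s\<close> forces two vertices.\<close>
    define k where "k = card Q - 2"
    define C where "C = (real (card s))\<^sup>2 * (2 * 2 ^ k)"
    have lim_T: "(\<lambda>n. T' (\<phi> n) m) \<longlonglongrightarrow> T m" for m
      unfolding T_def T'_def
      by (rule step_density_tendsto[OF lim_a lim_e _ Q(1,2)])
        (use a'_range e'_nonneg e'_le in \<open>auto intro!: always_eventually\<close>)
    have lim_t: "(\<lambda>n. t' (\<phi> n)) \<longlonglongrightarrow> t"
      using LIMSEQ_subseq_LIMSEQ[OF t \<phi>] by (simp add: o_def t'_def)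
    \<comment> \<open>The limit is taken at fixed \<open>M\<close>, where only finitely many levels
      occur. Taking the index beyond \<open>k + M\<close> makes the energy bound for
      \<open>k\<close> available and all those levels present; \<open>C\<close> depends on
      neither.\<close>
    have bound: "(\<Sum>m<M. (t - T m)\<^sup>2) \<le> C" for M
    proof (rule tendsto_upperbound)
      show "(\<lambda>n. \<Sum>m<M. (t' (\<phi> n) - T' (\<phi> n) m)\<^sup>2) \<longlonglongrightarrow> (\<Sum>m<M. (t - T m)\<^sup>2)"
        by (intro tendsto_intros lim_T lim_t)
      show "\<forall>\<^sub>F n in sequentially. (\<Sum>m<M. (t' (\<phi> n) - T' (\<phi> n) m)\<^sup>2) \<le> C"
        using ev[of "k + M"]
      proof eventually_elim
        case (elim n)
        define N where "N = \<phi> n"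
        have N: "P N \<noteq> {}" "k < N" "M \<le> N" using elim by (auto simp: N_def)
        let ?g = "\<lambda>m. iter_avg (P N) (?E N) k (take m (z N)) - ?E N (take m (z N))"
        have ge: "?g m \<ge> 0" for m
          using iter_avg_ge[OF fin N(1), of "?E N" "take m (z N)" k]
            code_energy_append_ge[OF fin[of N], of "r N"] by simp
        have "(t' N - T' N m)\<^sup>2 \<le> (real (card s))\<^sup>2 * ?g m" if "m < N" for m
        proof -
          have "\<bar>t' N - T' N m\<bar> \<le> real (card s) * sqrt (?g m)"
            using poset_density_step_density_diff[OF fin N(1) sub asym Q, of "take m (z N)"] that z(1)[OF N(1)]
            by (simp add: t'_def T'_def a'_def e'_def k_def[symmetric] min_def)
          then have "\<bar>t' N - T' N m\<bar>\<^sup>2 \<le> (real (card s) * sqrt (?g m))\<^sup>2"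
            by (rule power_mono) simp
          then show ?thesis using ge by (simp add: power_mult_distrib)
        qed
        then have "(\<Sum>m<M. (t' N - T' N m)\<^sup>2) \<le> (\<Sum>m<M. (real (card s))\<^sup>2 * ?g m)"
          using N by (intro sum_mono) auto
        also have "\<dots> \<le> (\<Sum>m<N. (real (card s))\<^sup>2 * ?g m)"
          using N ge by (intro sum_mono2) auto
        also have "\<dots> \<le> C"
          unfolding C_def sum_distrib_left[symmetric] using z(2)[OF N(1,2)] by (intro mult_left_mono) auto
        finally show ?case by (simp add: N_def)
      qed
    qed simp
    have "summable (\<lambda>m. (t - T m)\<^sup>2)"
      by (rule summableI_nonneg_bounded[of _ C]) (use bound in auto)
    then have "(\<lambda>m. (t - T m)\<^sup>2) \<longlonglongrightarrow> 0" by (rule summable_LIMSEQ_zero)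
    then have "(\<lambda>m. t - T m) \<longlonglongrightarrow> 0"
      by (simp add: tendsto_null_power)
    from tendsto_diff[OF tendsto_const[of t] this] show ?thesis by (simp add: T_def)
  qed
  ultimately show ?thesis by blast
qed

section \<open>The unit interval and its nested cells\<close>

lemma prob_space_unit_interval: "prob_space unit_interval_measure"
proof
  show "emeasure unit_interval_measure (space unit_interval_measure) = 1"
    by (simp add: unit_interval_measure_def space_restrict_space emeasure_restrict_space)
qed

interpretation unit: prob_space unit_interval_measure
  by (rule prob_space_unit_interval)

interpretation unit2: pair_prob_space unit_interval_measure unit_interval_measure ..

lemma space_unit [simp]: "space unit_interval_measure = {0..1}"
  by (simp add: unit_interval_measure_def space_restrict_space)

lemma sets_unit: "sets unit_interval_measure = sets (restrict_space borel {0..1})"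
  by (simp add: unit_interval_measure_def sets_restrict_space)

lemma measurable_unit: "f \<in> borel_measurable borel \<Longrightarrow> f \<in> unit_interval_measure \<rightarrow>\<^sub>M borel"
  unfolding measurable_cong_sets[OF sets_unit refl] by (rule measurable_restrict_space1)

lemma measurable_unit_indicator [measurable]:
  "A \<in> sets borel \<Longrightarrow> (indicator A :: real \<Rightarrow> real) \<in> borel_measurable unit_interval_measure"
  by (rule measurable_unit) simp

lemma integral_unit_indicator:
  assumes "0 \<le> l" "l \<le> u" "u \<le> 1"
  shows "(\<integral>x. (indicator {l..<u} x :: real) \<partial>unit_interval_measure) = u - l"
proof -
  have "(\<integral>x. (indicator {l..<u} x :: real) \<partial>unit_interval_measure) = (\<integral>x. indicator {0..1} x *\<^sub>R indicator {l..<u} x \<partial>lborel)"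
    unfolding unit_interval_measure_def by (rule integral_restrict_space) simp
  also have "\<dots> = (\<integral>x. indicator {l..<u} x \<partial>lborel)"
    using assms by (intro Bochner_Integration.integral_cong) (auto simp: indicator_def)
  finally show ?thesis using assms by simp
qed

lemma AE_unit_less_1: "AE x in unit_interval_measure. x \<in> {0..<1}"
proof -
  have "AE x in lborel. x \<noteq> (1::real)" by (rule AE_lborel_singleton)
  then have "AE x in lborel. x \<in> {0..1} \<longrightarrow> x \<in> {0..<1::real}"
    by eventually_elim auto
  then show ?thesis
    unfolding unit_interval_measure_def by (subst AE_restrict_space_iff) simp_all
qed

section \<open>Marginals of finite product measures\<close>

lemma (in prob_space) distr_PiM_pair:
  assumes "finite Q" "a \<in> Q" "b \<in> Q" "a \<noteq> b"
  shows "distr (\<Pi>\<^sub>M q\<in>Q. M) (M \<Otimes>\<^sub>M M) (\<lambda>x. (x a, x b)) = M \<Otimes>\<^sub>M M"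
proof -
  interpret product_sigma_finite "\<lambda>_. M" ..
  interpret P: prob_space "\<Pi>\<^sub>M q\<in>Q. M" by (rule prob_space_PiM) (rule prob_space_axioms)
  have m: "(\<lambda>x. (x a, x b)) \<in> (\<Pi>\<^sub>M q\<in>Q. M) \<rightarrow>\<^sub>M M \<Otimes>\<^sub>M M"
    using assms by measurable
  show ?thesis
  proof (rule pair_measure_eqI[symmetric])
    fix A B assume AB: "A \<in> sets M" "B \<in> sets M"
    let ?X = "\<lambda>q. if q = a then A else if q = b then B else space M"
    have "x \<in> (\<lambda>x. (x a, x b)) -` (A \<times> B) \<inter> space (\<Pi>\<^sub>M q\<in>Q. M) \<longleftrightarrow> x \<in> PiE Q ?X" for x
    proof -
      have "(x a \<in> A \<and> x b \<in> B \<and> (\<forall>q\<in>Q. x q \<in> space M)) \<longleftrightarrow> (\<forall>q\<in>Q. x q \<in> ?X q)"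
        using assms(2-4) AB[THEN sets.sets_into_space] by (auto dest: bspec[of Q _ a] bspec[of Q _ b])
      then show ?thesis by (auto simp only: space_PiM PiE_iff vimage_eq Int_iff mem_Times_iff fst_conv snd_conv)
    qed
    then have "(\<lambda>x. (x a, x b)) -` (A \<times> B) \<inter> space (\<Pi>\<^sub>M q\<in>Q. M) = PiE Q ?X"
      by (rule set_eqI)
    then have "emeasure (distr (\<Pi>\<^sub>M q\<in>Q. M) (M \<Otimes>\<^sub>M M) (\<lambda>x. (x a, x b))) (A \<times> B) = (\<Prod>q\<in>Q. emeasure M (?X q))"
      using m AB assms by (simp add: emeasure_distr emeasure_PiM)
    also have "\<dots> = (\<Prod>q\<in>{a, b}. emeasure M (?X q))"
      using assms by (intro prod.mono_neutral_right) (auto simp: emeasure_space_1)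
    finally show "emeasure M A * emeasure M B
        = emeasure (distr (\<Pi>\<^sub>M q\<in>Q. M) (M \<Otimes>\<^sub>M M) (\<lambda>x. (x a, x b))) (A \<times> B)"
      using assms by simp
  qed (auto intro: sigma_finite_measure_axioms)
qed

text \<open>Distinctness of \<open>a\<close> and \<open>b\<close> matters: the map to
  \<open>(x a, x a)\<close> lands on the diagonal, where a statement that holds almost everywhere on
  the square may fail.\<close>

lemma (in prob_space) AE_PiM_pair:
  assumes "finite Q" "a \<in> Q" "b \<in> Q" "a \<noteq> b" "AE p in M \<Otimes>\<^sub>M M. P p"
  shows "AE x in (\<Pi>\<^sub>M q\<in>Q. M). P (x a, x b)"
proof -
  have m: "(\<lambda>x. (x a, x b)) \<in> (\<Pi>\<^sub>M q\<in>Q. M) \<rightarrow>\<^sub>M M \<Otimes>\<^sub>M M" using assms(2,3) by measurable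
  show ?thesis
    by (rule AE_distrD[OF m]) (simp only: distr_PiM_pair[OF assms(1-4)] assms(5))
qed

text \<open>The outer points \<open>x\<close> and \<open>z\<close> are grouped and the middle point
  \<open>y\<close> comes last, so that Fubini yields "for almost every pair (x, z), for almost every
  y".\<close>

lemma (in prob_space) PiM_three_eq_distr:
  fixes a b c :: 'q
  assumes "distinct [a, b, c]"
  shows "(\<Pi>\<^sub>M q\<in>{a, b, c}. M) = distr ((M \<Otimes>\<^sub>M M) \<Otimes>\<^sub>M M) (\<Pi>\<^sub>M q\<in>{a, b, c}. M)
    (\<lambda>((x, z), y). \<lambda>q\<in>{a, b, c}. if q = a then x else if q = b then y else z)"
proof -
  interpret product_sigma_finite "\<lambda>_. M" ..
  let ?f = "\<lambda>p q. if q = a then fst (fst p) else if q = b then snd p else snd (fst p)"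
  have f: "(\<lambda>p. \<lambda>q\<in>{a, b, c}. ?f p q) \<in> (M \<Otimes>\<^sub>M M) \<Otimes>\<^sub>M M \<rightarrow>\<^sub>M (\<Pi>\<^sub>M q\<in>{a, b, c}. M)"
    by measurable
  show ?thesis unfolding case_prod_unfold
  proof (rule PiM_eqI[symmetric])
    fix A assume A: "\<And>q. q \<in> {a, b, c} \<Longrightarrow> A q \<in> sets M"
    have "(\<lambda>p. \<lambda>q\<in>{a, b, c}. ?f p q) -` PiE {a, b, c} A \<inter> space ((M \<Otimes>\<^sub>M M) \<Otimes>\<^sub>M M) = (A a \<times> A c) \<times> A b"
      using assms A[THEN sets.sets_into_space] by (auto simp: space_pair_measure PiE_iff)
    moreover have "emeasure ((M \<Otimes>\<^sub>M M) \<Otimes>\<^sub>M M) ((A a \<times> A c) \<times> A b) = emeasure M (A a) * emeasure M (A c) * emeasure M (A b)"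
      using A by (simp add: emeasure_pair_measure_Times)
    moreover have "PiE {a, b, c} A \<in> sets (\<Pi>\<^sub>M q\<in>{a, b, c}. M)"
      by (rule sets_PiM_I_finite) (simp_all add: A)
    ultimately show "emeasure (distr ((M \<Otimes>\<^sub>M M) \<Otimes>\<^sub>M M) (\<Pi>\<^sub>M q\<in>{a, b, c}. M) (\<lambda>p. \<lambda>q\<in>{a, b, c}. ?f p q)) (PiE {a, b, c} A)
        = (\<Prod>q\<in>{a, b, c}. emeasure M (A q))"
      using assms f by (simp add: emeasure_distr mult_ac)
  qed auto
qed

text \<open>Nonnegativity of the variance of the absolute value of \<open>f\<close>.\<close>

lemma (in prob_space) integral_abs_le_sqrt:
  fixes f :: "'a \<Rightarrow> real"
  assumes [measurable]: "f \<in> borel_measurable M" and B: "\<And>x. \<bar>f x\<bar> \<le> B"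
  shows "(\<integral>x. \<bar>f x\<bar> \<partial>M) \<le> sqrt (\<integral>x. (f x)\<^sup>2 \<partial>M)"
proof -
  have sq: "norm (\<bar>f x\<bar>\<^sup>2) \<le> B\<^sup>2" for x
    using power_mono[OF B[of x] abs_ge_zero, of 2] by simp
  have 1: "integrable M (\<lambda>x. \<bar>f x\<bar>)"
    by (rule integrable_const_bound[of _ B]) (simp_all add: B)
  have 2: "integrable M (\<lambda>x. \<bar>f x\<bar>\<^sup>2)"
    by (rule integrable_const_bound[of _ "B\<^sup>2"]) (rule AE_I2, rule sq, measurable)
  have "(\<integral>x. \<bar>f x\<bar> \<partial>M)\<^sup>2 \<le> (\<integral>x. \<bar>f x\<bar>\<^sup>2 \<partial>M)"
    using variance_eq[OF 1 2] variance_positive[of "\<lambda>x. \<bar>f x\<bar>"] by simp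
  then show ?thesis by (intro real_le_rsqrt) simp
qed

lemma sum_three: "(\<Sum>d<3. f d) = f 0 + f 1 + f (2::nat)" for f :: "nat \<Rightarrow> real"
  by (simp add: eval_nat_numeral)

section \<open>Cells: intervals whose lengths are the limiting type frequencies\<close>

context edge_limit
begin

definition left_end :: "nat \<Rightarrow> nat \<Rightarrow> real" where
  "left_end m i = (\<Sum>j<i. a m j)"

text \<open>Half-open, so that the cells of a level partition [0,1) exactly and a type of frequency
  0 gets the empty cell.\<close>

definition cell :: "nat \<Rightarrow> nat \<Rightarrow> real set" where
  "cell m i = {left_end m i..<left_end m (Suc i)}"

lemma left_end_Suc: "left_end m (Suc i) = left_end m i + a m i"
  by (simp add: left_end_def)

lemma left_end_0 [simp]: "left_end m 0 = 0"
  by (simp add: left_end_def)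

text \<open>The three refinements of a type have consecutive codes and the same total length, so
  endpoints persist at the next level and the cells nest.\<close>

lemma left_end_split: "left_end (Suc m) (3 * i) = left_end m i"
proof (induction i)
  case (Suc i)
  have eq: "3 * Suc i = Suc (Suc (Suc (3 * i)))" by simp
  have "left_end (Suc m) (3 * Suc i) = left_end m i + (\<Sum>d<3. a (Suc m) (3 * i + d))"
    unfolding eq left_end_Suc sum_three Suc by simp
  then show ?case by (simp add: left_end_Suc a_split[of m])
qed simp

lemma left_end_mono: "i \<le> j \<Longrightarrow> left_end m i \<le> left_end m j"
  by (rule lift_Suc_mono_le[of "left_end m"]) (simp_all add: left_end_Suc a_nonneg)

lemma left_end_last: "left_end m (3 ^ m) = 1"
proof (induction m)
  case 0
  then show ?case by (simp add: left_end_def a_root)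
qed (simp add: left_end_split)

lemma left_end_range: "left_end m i \<in> {0..1}"
proof -
  have "left_end m (3 ^ m + k) = 1" for k
    by (induction k) (simp_all add: left_end_last left_end_Suc a_eq_0)
  then have "left_end m i \<le> 1"
    using left_end_mono[of i "3 ^ m + i" m] by simp
  then show ?thesis using left_end_mono[of 0 i m] by simp
qed

lemma cell_subset: "cell m i \<subseteq> {0..<1}"
  using left_end_range[of m i] left_end_range[of m "Suc i"] by (auto simp: cell_def)

lemma cell_borel [measurable]: "cell m i \<in> sets borel"
  by (simp add: cell_def)

lemma integral_cell: "(\<integral>x. indicator (cell m i) x \<partial>unit_interval_measure) = a m i"
  unfolding cell_def using left_end_range[of m i] left_end_range[of m "Suc i"] left_end_mono[of i "Suc i" m]
  by (subst integral_unit_indicator) (auto simp: left_end_Suc)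

lemma cell_split_indicator:
  "(indicator (cell m i) x :: real) = (\<Sum>d<3. indicator (cell (Suc m) (3 * i + d)) x)"
proof -
  define f where "f d = left_end (Suc m) (3 * i + d)" for d
  have cells: "cell (Suc m) (3 * i + d) = {f d..<f (Suc d)}" for d
    by (simp add: cell_def f_def)
  have "cell m i = {f 0..<f 3}"
    using left_end_split[of m i] left_end_split[of m "Suc i"] by (simp add: cell_def f_def add.commute)
  moreover have "f 0 \<le> f 1" "f 1 \<le> f 2" "f 2 \<le> f 3"
    unfolding f_def by (rule left_end_mono, simp)+
  ultimately show ?thesis
    unfolding sum_three cells by (auto simp: indicator_def eval_nat_numeral)
qed

text \<open>The index of the cell containing \<open>x\<close>; meaningful only for \<open>0 \<le> x < 1\<close>.\<close>

definition idx :: "nat \<Rightarrow> real \<Rightarrow> nat" where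
  "idx m x = (LEAST i. x < left_end m (Suc i))"

lemma idx_less:
  assumes "x \<in> {0..<1}"
  shows "x < left_end m (Suc (idx m x))" "idx m x < 3 ^ m"
proof -
  have *: "x < left_end m (Suc (3 ^ m - 1))" using assms by (simp add: left_end_last)
  then show "x < left_end m (Suc (idx m x))" unfolding idx_def by (rule LeastI)
  have "idx m x \<le> 3 ^ m - 1" unfolding idx_def using * by (rule Least_le)
  then show "idx m x < 3 ^ m" by (simp add: le_diff_conv2 Suc_le_eq[symmetric])
qed

lemma idx_cell:
  assumes "x \<in> {0..<1}"
  shows "x \<in> cell m (idx m x)"
proof -
  have "left_end m (idx m x) \<le> x"
  proof (cases "idx m x")
    case 0
    then show ?thesis using assms by simp
  next
    case (Suc j)
    then have "\<not> x < left_end m (Suc j)" unfolding idx_def by (intro not_less_Least) simp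
    then show ?thesis using Suc by simp
  qed
  then show ?thesis using idx_less(1)[OF assms] by (simp add: cell_def)
qed

lemma cell_iff_idx: "x \<in> {0..<1} \<Longrightarrow> x \<in> cell m i \<longleftrightarrow> idx m x = i"
proof
  assume x: "x \<in> {0..<1}" and i: "x \<in> cell m i"
  show "idx m x = i"
  proof (rule ccontr)
    assume "idx m x \<noteq> i"
    then have "left_end m (Suc (idx m x)) \<le> left_end m i \<or> left_end m (Suc i) \<le> left_end m (idx m x)"
      by (metis left_end_mono linorder_neqE_nat Suc_leI)
    then show False
      using i idx_cell[OF x, of m] unfolding cell_def by auto
  qed
qed (use idx_cell in blast)

lemma idx_mono:
  assumes "x \<le> y" "y \<in> {0..<1}"
  shows "idx m x \<le> idx m y"
  unfolding idx_def[of m x] using assms idx_less(1)[OF assms(2), of m] by (intro Least_le) simp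

lemma idx_Suc_div: "x \<in> {0..<1} \<Longrightarrow> idx m x = idx (Suc m) x div 3"
proof -
  assume x: "x \<in> {0..<1}"
  define i where "i = idx (Suc m) x"
  have "(indicator (cell (Suc m) (3 * (i div 3) + i mod 3)) x :: real)
      \<le> (\<Sum>d<3. indicator (cell (Suc m) (3 * (i div 3) + d)) x)"
    by (rule member_le_sum) auto
  moreover have "x \<in> cell (Suc m) i" using idx_cell[OF x] by (simp add: i_def)
  ultimately have "1 \<le> (indicator (cell m (i div 3)) x :: real)"
    by (simp add: cell_split_indicator[symmetric])
  then have "x \<in> cell m (i div 3)" by (cases "x \<in> cell m (i div 3)") simp_all
  then show ?thesis using cell_iff_idx[OF x] by (simp add: i_def)
qed

lemma idx_eq_mono:
  assumes "x \<in> {0..<1}" "y \<in> {0..<1}" "m \<le> n" "idx n x = idx n y"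
  shows "idx m x = idx m y"
  using assms(3,4)
proof (induction rule: inc_induct)
  case (step k)
  then show ?case by (simp only: idx_Suc_div[OF assms(1), of k] idx_Suc_div[OF assms(2), of k])
qed

text \<open>A half-open interval containing a point has positive length; hence the denominators of
  densities at points of [0,1) never vanish.\<close>

lemma a_idx_pos: "x \<in> {0..<1} \<Longrightarrow> 0 < a m (idx m x)"
  using idx_cell[of x m] by (simp add: cell_def left_end_Suc)

end

section \<open>The martingale of step kernels\<close>

abbreviation unit_square_measure :: "(real \<times> real) measure" where
  "unit_square_measure \<equiv> unit_interval_measure \<Otimes>\<^sub>M unit_interval_measure"

text \<open>The bound is asked at all pairs of reals, also off the square. The class is closed under
  the algebraic operations, so integrability follows from introduction rules alone.\<close>

definition bounded_measurable :: "(real \<times> real \<Rightarrow> real) \<Rightarrow> bool" where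
  "bounded_measurable f \<longleftrightarrow> f \<in> borel_measurable unit_square_measure \<and> (\<exists>B. \<forall>p. \<bar>f p\<bar> \<le> B)"

lemma bounded_measurableI:
  "f \<in> borel_measurable unit_square_measure \<Longrightarrow> (\<And>p. \<bar>f p\<bar> \<le> B) \<Longrightarrow> bounded_measurable f"
  by (auto simp: bounded_measurable_def)

lemma bounded_measurable_integrable:
  assumes "bounded_measurable f"
  shows "integrable unit_square_measure f"
proof -
  obtain B where "\<And>p. \<bar>f p\<bar> \<le> B" using assms by (auto simp: bounded_measurable_def)
  then show ?thesis
    using assms by (intro unit2.P.integrable_const_bound[of _ B] AE_I2) (simp_all add: bounded_measurable_def)
qed

lemma bounded_measurable_const: "bounded_measurable (\<lambda>_. c)"
  by (rule bounded_measurableI[of _ "\<bar>c\<bar>"]) auto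

lemma bounded_measurable_mult:
  assumes "bounded_measurable f" "bounded_measurable g"
  shows "bounded_measurable (\<lambda>p. f p * g p)"
proof -
  obtain B C where "\<And>p. \<bar>f p\<bar> \<le> B" "\<And>p. \<bar>g p\<bar> \<le> C" using assms by (auto simp: bounded_measurable_def)
  then have "\<bar>f p * g p\<bar> \<le> B * C" for p
    unfolding abs_mult by (meson abs_ge_zero mult_mono order_trans)
  then show ?thesis
    using assms by (intro bounded_measurableI[of _ "B * C"] borel_measurable_times) (auto simp: bounded_measurable_def)
qed

lemma bounded_measurable_add:
  assumes "bounded_measurable f" "bounded_measurable g"
  shows "bounded_measurable (\<lambda>p. f p + g p)"
proof -
  obtain B C where B: "\<And>p. \<bar>f p\<bar> \<le> B" "\<And>p. \<bar>g p\<bar> \<le> C" using assms by (auto simp: bounded_measurable_def)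
  have "\<bar>f p + g p\<bar> \<le> B + C" for p
    using B[of p] by linarith
  then show ?thesis
    using assms by (intro bounded_measurableI[of _ "B + C"] borel_measurable_add) (auto simp: bounded_measurable_def)
qed

lemma bounded_measurable_diff:
  assumes "bounded_measurable f" "bounded_measurable g"
  shows "bounded_measurable (\<lambda>p. f p - g p)"
  using bounded_measurable_add[OF assms(1) bounded_measurable_mult[OF bounded_measurable_const[of "-1"] assms(2)]]
  by simp

lemma bounded_measurable_abs: "bounded_measurable f \<Longrightarrow> bounded_measurable (\<lambda>p. \<bar>f p\<bar>)"
  by (auto simp: bounded_measurable_def)

lemma bounded_measurable_sum:
  "(\<And>i. i \<in> K \<Longrightarrow> bounded_measurable (f i)) \<Longrightarrow> bounded_measurable (\<lambda>p. \<Sum>i\<in>K. f i p)"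
  by (induction K rule: infinite_finite_induct)
    (simp_all add: bounded_measurable_const bounded_measurable_add)

lemma bounded_measurable_square: "bounded_measurable f \<Longrightarrow> bounded_measurable (\<lambda>p. (f p)\<^sup>2)"
  unfolding power2_eq_square by (rule bounded_measurable_mult)

lemmas bounded_measurable_intros =
  bounded_measurable_const bounded_measurable_mult bounded_measurable_add bounded_measurable_diff
  bounded_measurable_abs bounded_measurable_sum bounded_measurable_square

lemma bounded_measurable_measurable:
  "bounded_measurable f \<Longrightarrow> f \<in> borel_measurable unit_square_measure"
  by (simp add: bounded_measurable_def)

context edge_limit
begin

definition block :: "nat \<Rightarrow> nat \<Rightarrow> nat \<Rightarrow> real \<times> real \<Rightarrow> real" where
  "block m i j p = indicator (cell m i) (fst p) * indicator (cell m j) (snd p)"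

definition block_integral :: "nat \<Rightarrow> nat \<Rightarrow> nat \<Rightarrow> (real \<times> real \<Rightarrow> real) \<Rightarrow> real" where
  "block_integral m i j f = (\<integral>p. block m i j p * f p \<partial>unit_square_measure)"

definition step_fun :: "nat \<Rightarrow> (nat \<Rightarrow> nat \<Rightarrow> real) \<Rightarrow> real \<times> real \<Rightarrow> real" where
  "step_fun m c p = (\<Sum>i<3 ^ m. \<Sum>j<3 ^ m. c i j * block m i j p)"

definition step_kernel :: "nat \<Rightarrow> real \<times> real \<Rightarrow> real" where
  "step_kernel m = step_fun m (\<lambda>i j. e m i j / (a m i * a m j))"

lemma block_range: "block m i j p \<in> {0..1}"
  by (simp add: block_def indicator_def)

lemma block_bounded_measurable: "bounded_measurable (block m i j)"
  by (rule bounded_measurableI[of _ 1]) (unfold block_def, measurable, simp add: indicator_def)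

lemma block_eq:
  "fst p \<in> {0..<1} \<Longrightarrow> snd p \<in> {0..<1} \<Longrightarrow>
    block m i j p = of_bool (i = idx m (fst p) \<and> j = idx m (snd p))"
  by (auto simp: block_def indicator_def cell_iff_idx)

lemma block_outside:
  "\<not> (fst p \<in> {0..<1} \<and> snd p \<in> {0..<1}) \<Longrightarrow> block m i j p = 0"
  using cell_subset[of m i] cell_subset[of m j] by (auto simp: block_def indicator_def)

lemma step_fun_eq:
  assumes "fst p \<in> {0..<1}" "snd p \<in> {0..<1}"
  shows "step_fun m c p = c (idx m (fst p)) (idx m (snd p))"
proof -
  have "c i j * block m i j p = (if i = idx m (fst p) then if j = idx m (snd p) then c i j else 0 else 0)" for i j
    by (simp add: block_eq[OF assms])
  then have "step_fun m c p = (\<Sum>i<3 ^ m. if i = idx m (fst p) then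
      (\<Sum>j<3 ^ m. if j = idx m (snd p) then c i j else 0) else 0)"
    unfolding step_fun_def by (intro sum.cong) auto
  also have "\<dots> = c (idx m (fst p)) (idx m (snd p))"
    using idx_less(2)[OF assms(1), of m] idx_less(2)[OF assms(2), of m] by simp
  finally show ?thesis .
qed

lemma step_fun_outside:
  "\<not> (fst p \<in> {0..<1} \<and> snd p \<in> {0..<1}) \<Longrightarrow> step_fun m c p = 0"
  by (simp add: step_fun_def block_outside)

lemma step_fun_bounded_measurable: "bounded_measurable (step_fun m c)"
  unfolding step_fun_def by (intro bounded_measurable_intros block_bounded_measurable)

lemma block_step_fun: "block m i j p * step_fun m c p = c i j * block m i j p"
proof (cases "fst p \<in> {0..<1} \<and> snd p \<in> {0..<1}")
  case True
  then show ?thesis by (auto simp: step_fun_eq block_eq)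
qed (simp add: block_outside)

lemma step_kernel_bounded_measurable: "bounded_measurable (step_kernel m)"
  unfolding step_kernel_def by (rule step_fun_bounded_measurable)

lemma e_ratio_range: "e m i j / (a m i * a m j) \<in> {0..1}"
  using e_nonneg[of m i j] e_le[of m i j] a_nonneg[of m]
  by (auto intro!: divide_nonneg_nonneg simp: divide_le_eq_1 less_le)

lemma step_kernel_range: "step_kernel m p \<in> {0..1}"
proof (cases "fst p \<in> {0..<1} \<and> snd p \<in> {0..<1}")
  case True
  then show ?thesis unfolding step_kernel_def using e_ratio_range by (simp add: step_fun_eq)
qed (simp add: step_kernel_def step_fun_outside)

lemma integral_fst_mult_snd:
  fixes f g :: "real \<Rightarrow> real"
  assumes "integrable unit_interval_measure f" "integrable unit_interval_measure g"
  shows "(\<integral>p. f (fst p) * g (snd p) \<partial>unit_square_measure)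
    = (\<integral>x. f x \<partial>unit_interval_measure) * (\<integral>x. g x \<partial>unit_interval_measure)"
proof -
  have [measurable]: "f \<in> borel_measurable unit_interval_measure" "g \<in> borel_measurable unit_interval_measure"
    using assms by (simp_all add: borel_measurable_integrable)
  have "integrable unit_square_measure (\<lambda>p. f (fst p) * g (snd p))"
    by (rule unit2.Fubini_integrable) (use assms in \<open>simp_all add: abs_mult\<close>)
  from unit2.integral_fst'[OF this] show ?thesis using assms by simp
qed

lemma block_integral_1: "block_integral m i j (\<lambda>_. 1) = a m i * a m j"
proof -
  have int: "integrable unit_interval_measure (indicator (cell m i) :: real \<Rightarrow> real)" for i
    by (rule unit.integrable_const_bound[of _ 1]) auto
  show ?thesis unfolding block_integral_def block_def
    using integral_fst_mult_snd[OF int int, of i j] unfolding integral_cell by simp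
qed

lemma block_integral_mono:
  assumes "bounded_measurable f" "bounded_measurable g"
    and "\<And>p. block m i j p \<noteq> 0 \<Longrightarrow> f p \<le> g p"
  shows "block_integral m i j f \<le> block_integral m i j g"
  unfolding block_integral_def
proof (rule integral_mono)
  fix p
  show "block m i j p * f p \<le> block m i j p * g p"
    using assms(3)[of p] block_range[of m i j p] by (cases "block m i j p = 0") (auto intro!: mult_left_mono)
qed (intro bounded_measurable_integrable bounded_measurable_intros block_bounded_measurable assms)+

lemma block_integral_cmult: "block_integral m i j (\<lambda>p. c * f p) = c * block_integral m i j f"
  by (simp add: block_integral_def mult.left_commute)

lemma block_integral_add:
  assumes "bounded_measurable f" "bounded_measurable g"
  shows "block_integral m i j (\<lambda>p. f p + g p) = block_integral m i j f + block_integral m i j g"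
  unfolding block_integral_def distrib_left
  by (intro Bochner_Integration.integral_add bounded_measurable_integrable bounded_measurable_intros block_bounded_measurable assms)

lemma block_integral_diff:
  assumes "bounded_measurable f" "bounded_measurable g"
  shows "block_integral m i j (\<lambda>p. f p - g p) = block_integral m i j f - block_integral m i j g"
  unfolding block_integral_def right_diff_distrib
  by (intro Bochner_Integration.integral_diff bounded_measurable_integrable bounded_measurable_intros block_bounded_measurable assms)

lemma integral_step_fun_mult:
  assumes "bounded_measurable f"
  shows "(\<integral>p. step_fun m c p * f p \<partial>unit_square_measure)
    = (\<Sum>i<3 ^ m. \<Sum>j<3 ^ m. c i j * block_integral m i j f)"
proof -
  have "(\<integral>p. step_fun m c p * f p \<partial>unit_square_measure)
      = (\<integral>p. (\<Sum>i<3 ^ m. \<Sum>j<3 ^ m. c i j * (block m i j p * f p)) \<partial>unit_square_measure)"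
    by (simp add: step_fun_def sum_distrib_right mult.assoc)
  also have "\<dots> = (\<Sum>i<3 ^ m. \<Sum>j<3 ^ m. \<integral>p. c i j * (block m i j p * f p) \<partial>unit_square_measure)"
    by (subst Bochner_Integration.integral_sum)
      (intro bounded_measurable_integrable bounded_measurable_intros block_bounded_measurable assms
        sum.cong refl Bochner_Integration.integral_sum)+
  finally show ?thesis by (simp add: block_integral_def)
qed

lemma block_split:
  "block m i j p = (\<Sum>(c, d)\<in>{..<3} \<times> {..<3}. block (Suc m) (3 * i + c) (3 * j + d) p)"
  unfolding block_def cell_split_indicator[of m] sum_product sum.cartesian_product case_prod_unfold ..

lemma block_integral_split:
  assumes "bounded_measurable f"
  shows "block_integral m i j f
    = (\<Sum>(c, d)\<in>{..<3} \<times> {..<3}. block_integral (Suc m) (3 * i + c) (3 * j + d) f)"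
  unfolding block_integral_def block_split[of m i j] sum_distrib_right case_prod_unfold
  by (intro Bochner_Integration.integral_sum bounded_measurable_integrable bounded_measurable_intros
      block_bounded_measurable assms)

text \<open>The martingale property: a finer step kernel has the same integral over a coarse block.
  Downward induction on the level, by additivity of the edge frequencies.\<close>

lemma block_integral_step_kernel: "m \<le> n \<Longrightarrow> block_integral m i j (step_kernel n) = e m i j"
proof (induction m arbitrary: i j rule: inc_induct)
  case base
  have "block_integral n i j (step_kernel n) = e n i j / (a n i * a n j) * block_integral n i j (\<lambda>_. 1)"
    unfolding block_integral_def step_kernel_def block_step_fun by simp
  \<comment> \<open>If a side of the block has length 0, the quotient is 0, and so is the edge
    frequency by \<open>e_le\<close>.\<close>
  also have "\<dots> = e n i j"
    using e_nonneg[of n i j] e_le[of n i j] by (auto simp: block_integral_1)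
  finally show ?case .
next
  case (step m)
  show ?case
    by (simp only: block_integral_split[OF step_kernel_bounded_measurable, of m i j] e_split[of m i j] step.IH)
qed

section \<open>Energies of the step kernels and their limit\<close>

definition kernel_energy :: "nat \<Rightarrow> real" where
  "kernel_energy m = (\<integral>p. (step_kernel m p)\<^sup>2 \<partial>unit_square_measure)"

text \<open>Orthogonality of martingale increments: the coarse factor is constant on its blocks, and
  both kernels have equal integrals over these blocks.\<close>

lemma integral_step_kernel_mult:
  assumes "m \<le> n"
  shows "(\<integral>p. step_kernel m p * step_kernel n p \<partial>unit_square_measure) = kernel_energy m"
proof -
  have "(\<integral>p. step_kernel m p * step_kernel k p \<partial>unit_square_measure)
      = (\<Sum>i<3 ^ m. \<Sum>j<3 ^ m. e m i j / (a m i * a m j) * e m i j)" if "m \<le> k" for k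
    unfolding step_kernel_def[of m] integral_step_fun_mult[OF step_kernel_bounded_measurable]
    using that by (simp add: block_integral_step_kernel)
  from this[of n] this[of m] assms show ?thesis
    by (simp add: kernel_energy_def power2_eq_square)
qed

lemma kernel_energy_diff:
  assumes "m \<le> n"
  shows "(\<integral>p. (step_kernel n p - step_kernel m p)\<^sup>2 \<partial>unit_square_measure)
    = kernel_energy n - kernel_energy m"
proof -
  note bm = bounded_measurable_integrable bounded_measurable_intros step_kernel_bounded_measurable
  have "(\<integral>p. (step_kernel n p - step_kernel m p)\<^sup>2 \<partial>unit_square_measure)
      = (\<integral>p. (step_kernel n p)\<^sup>2 - 2 * (step_kernel m p * step_kernel n p) + (step_kernel m p)\<^sup>2 \<partial>unit_square_measure)"
    by (rule Bochner_Integration.integral_cong) (simp_all add: power2_diff mult_ac)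
  also have "\<dots> = kernel_energy n - 2 * (\<integral>p. step_kernel m p * step_kernel n p \<partial>unit_square_measure) + kernel_energy m"
  proof -
    have "integrable unit_square_measure (\<lambda>p. (step_kernel n p)\<^sup>2)"
      "integrable unit_square_measure (\<lambda>p. (step_kernel m p)\<^sup>2)"
      "integrable unit_square_measure (\<lambda>p. step_kernel m p * step_kernel n p)"
      by (intro bm)+
    then show ?thesis by (simp add: kernel_energy_def)
  qed
  finally show ?thesis by (simp add: integral_step_kernel_mult[OF assms])
qed

lemma kernel_energy_le_1: "kernel_energy m \<le> 1"
proof -
  have "kernel_energy m \<le> (\<integral>p. 1 \<partial>unit_square_measure)"
    unfolding kernel_energy_def
  proof (rule integral_mono)
    fix p show "(step_kernel m p)\<^sup>2 \<le> 1"
      using step_kernel_range[of m p] by (auto intro: power_le_one)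
  qed (intro bounded_measurable_integrable bounded_measurable_intros step_kernel_bounded_measurable)+
  then show ?thesis by (simp add: unit2.P.prob_space)
qed

lemma kernel_energy_Cauchy: "Cauchy kernel_energy"
proof (rule convergent_Cauchy, rule Bseq_mono_convergent)
  have mono: "m \<le> n \<Longrightarrow> kernel_energy m \<le> kernel_energy n" for m n
  proof -
    have "0 \<le> (\<integral>p. (step_kernel n p - step_kernel m p)\<^sup>2 \<partial>unit_square_measure)"
      by (intro integral_nonneg_AE AE_I2) simp
    then show "m \<le> n \<Longrightarrow> kernel_energy m \<le> kernel_energy n" by (simp add: kernel_energy_diff)
  qed
  then show "\<forall>m n. m \<le> n \<longrightarrow> kernel_energy m \<le> kernel_energy n" by blast
  show "Bseq kernel_energy"
    by (rule BseqI'[of _ 1]) (use kernel_energy_le_1 in \<open>auto simp: kernel_energy_def\<close>)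
qed

lemma step_kernel_L1_diff_le:
  "(\<integral>p. \<bar>step_kernel i p - step_kernel j p\<bar> \<partial>unit_square_measure)
    \<le> sqrt \<bar>kernel_energy i - kernel_energy j\<bar>"
proof -
  have *: "(\<integral>p. \<bar>step_kernel n p - step_kernel m p\<bar> \<partial>unit_square_measure)
      \<le> sqrt \<bar>kernel_energy n - kernel_energy m\<bar>" if "m \<le> n" for m n
  proof -
    have "\<bar>step_kernel n p - step_kernel m p\<bar> \<le> 1" for p
      using step_kernel_range[of n p] step_kernel_range[of m p] by auto
    then have "(\<integral>p. \<bar>step_kernel n p - step_kernel m p\<bar> \<partial>unit_square_measure)
        \<le> sqrt (\<integral>p. (step_kernel n p - step_kernel m p)\<^sup>2 \<partial>unit_square_measure)"
      by (intro unit2.P.integral_abs_le_sqrt bounded_measurable_measurable bounded_measurable_diff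
          step_kernel_bounded_measurable)
    also have "\<dots> \<le> sqrt \<bar>kernel_energy n - kernel_energy m\<bar>"
      unfolding kernel_energy_diff[OF that] by simp
    finally show ?thesis .
  qed
  show ?thesis
    using *[of i j] *[of j i] by (cases "i \<le> j") (simp_all add: abs_minus_commute)
qed

text \<open>
  The deviation vanishes in the limit exactly at the Lebesgue points of \<open>W\<close> with respect to the blocks.
\<close>

definition deviation :: "(real \<times> real \<Rightarrow> real) \<Rightarrow> nat \<Rightarrow> real \<times> real \<Rightarrow> real" where
  "deviation W m = step_fun m (\<lambda>i j. block_integral m i j (\<lambda>p. \<bar>W p - step_kernel m p\<bar>) / (a m i * a m j))"

lemma block_integral_nonneg: "(\<And>p. 0 \<le> f p) \<Longrightarrow> 0 \<le> block_integral m i j f"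
  unfolding block_integral_def using block_range[of m i j] by (intro integral_nonneg_AE AE_I2) auto

lemma deviation_nonneg: "0 \<le> deviation W m p"
  unfolding deviation_def step_fun_def using block_range[of m] a_nonneg
  by (intro sum_nonneg mult_nonneg_nonneg divide_nonneg_nonneg block_integral_nonneg) auto

text \<open>Averaging over blocks does not increase the integral of a nonnegative function; blocks
  of measure 0 contribute 0.\<close>

lemma integral_deviation_le:
  assumes W: "bounded_measurable W"
  shows "(\<integral>p. deviation W m p \<partial>unit_square_measure) \<le> (\<integral>p. \<bar>W p - step_kernel m p\<bar> \<partial>unit_square_measure)"
proof -
  note bm = bounded_measurable_integrable bounded_measurable_intros step_kernel_bounded_measurable
    step_fun_bounded_measurable W
  let ?f = "\<lambda>p. \<bar>W p - step_kernel m p\<bar>"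
  have f: "bounded_measurable ?f" by (intro bm)
  have "(\<integral>p. deviation W m p \<partial>unit_square_measure) = (\<integral>p. deviation W m p * 1 \<partial>unit_square_measure)" by simp
  also have "\<dots> = (\<Sum>i<3 ^ m. \<Sum>j<3 ^ m. block_integral m i j ?f / (a m i * a m j) * (a m i * a m j))"
    unfolding deviation_def integral_step_fun_mult[OF bounded_measurable_const] block_integral_1 ..
  also have "\<dots> \<le> (\<Sum>i<3 ^ m. \<Sum>j<3 ^ m. 1 * block_integral m i j ?f)"
    using a_nonneg block_integral_nonneg[of ?f m] by (intro sum_mono) auto
  also have "\<dots> = (\<integral>p. step_fun m (\<lambda>_ _. 1) p * ?f p \<partial>unit_square_measure)"
    by (rule integral_step_fun_mult[OF f, symmetric])
  also have "\<dots> \<le> (\<integral>p. ?f p \<partial>unit_square_measure)"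
  proof (rule integral_mono)
    fix p
    have "step_fun m (\<lambda>_ _. 1) p \<in> {0..1}"
      by (cases "fst p \<in> {0..<1} \<and> snd p \<in> {0..<1}") (simp_all add: step_fun_eq step_fun_outside)
    then show "step_fun m (\<lambda>_ _. 1) p * ?f p \<le> ?f p" by (auto intro: mult_left_le_one_le)
  qed (intro bm)+
  finally show ?thesis .
qed

text \<open>Bounded increasing energies make the sequence Cauchy in L2, hence in L1, which gives an
  almost everywhere limit along \<open>r\<close>. The deviations are bounded in L1 by the distance
  to that limit, so a further subsequence makes them vanish almost everywhere too.\<close>

lemma limit_kernel_exists:
  obtains W q where "bounded_measurable W" "\<And>p. W p \<in> {0..1}" "strict_mono q"
    "AE p in unit_square_measure. (\<lambda>n. step_kernel (q n) p) \<longlonglongrightarrow> W p"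
    "AE p in unit_square_measure. (\<lambda>n. deviation W (q n) p) \<longlonglongrightarrow> 0"
proof -
  note bm = bounded_measurable_integrable bounded_measurable_intros step_kernel_bounded_measurable
  have L1: "\<exists>N. \<forall>i\<ge>N. \<forall>j\<ge>N. (LINT p|unit_square_measure. norm (step_kernel i p - step_kernel j p)) < \<epsilon>"
    if "\<epsilon> > 0" for \<epsilon>
  proof -
    have "0 < \<epsilon>\<^sup>2" using that by simp
    from CauchyD[OF kernel_energy_Cauchy this]
    obtain N where N: "\<And>i j. i \<ge> N \<Longrightarrow> j \<ge> N \<Longrightarrow> \<bar>kernel_energy i - kernel_energy j\<bar> < \<epsilon>\<^sup>2"
      by (auto simp: real_norm_def)
    have "(LINT p|unit_square_measure. norm (step_kernel i p - step_kernel j p)) < \<epsilon>" if "i \<ge> N" "j \<ge> N" for i j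
    proof -
      have "sqrt \<bar>kernel_energy i - kernel_energy j\<bar> < \<epsilon>"
        using N[OF that] \<open>\<epsilon> > 0\<close> by (intro real_less_lsqrt) auto
      then show ?thesis using step_kernel_L1_diff_le[of i j] by simp
    qed
    then show ?thesis by blast
  qed
  have "integrable unit_square_measure (step_kernel i)" for i by (intro bm)
  from cauchy_L1_AE_cauchy_subseq[OF this L1] obtain r where r: "strict_mono r"
    "AE p in unit_square_measure. Cauchy (\<lambda>i. step_kernel (r i) p)"
    by metis
  \<comment> \<open>Clamping makes \<open>W\<close> take values in the unit interval everywhere,
    also where the limit does not exist.\<close>
  define W where "W p = max 0 (min 1 (lim (\<lambda>i. step_kernel (r i) p)))" for p
  have W_range: "W p \<in> {0..1}" for p by (simp add: W_def)
  have W: "bounded_measurable W"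
  proof (rule bounded_measurableI[of _ 1])
    show "W \<in> borel_measurable unit_square_measure"
      unfolding W_def using bounded_measurable_measurable[OF step_kernel_bounded_measurable]
      by (intro borel_measurable_max borel_measurable_min borel_measurable_const borel_measurable_lim_metric)
    show "\<bar>W p\<bar> \<le> 1" for p using W_range[of p] by simp
  qed
  have lim: "AE p in unit_square_measure. (\<lambda>i. step_kernel (r i) p) \<longlonglongrightarrow> W p"
    using r(2)
  proof eventually_elim
    case (elim p)
    then have L: "(\<lambda>i. step_kernel (r i) p) \<longlonglongrightarrow> lim (\<lambda>i. step_kernel (r i) p)"
      by (simp add: Cauchy_convergent_iff convergent_LIMSEQ_iff)
    have "lim (\<lambda>i. step_kernel (r i) p) \<in> {0..1}"
      by (rule closed_sequentially[OF _ _ L]) (use step_kernel_range in auto)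
    with L show ?case by (simp add: W_def)
  qed
  have "(\<lambda>i. \<integral>p. \<bar>W p - step_kernel (r i) p\<bar> \<partial>unit_square_measure) \<longlonglongrightarrow> (\<integral>p. 0 \<partial>unit_square_measure)"
  proof (rule integral_dominated_convergence[where w = "\<lambda>_. 1"])
    show "AE p in unit_square_measure. (\<lambda>i. \<bar>W p - step_kernel (r i) p\<bar>) \<longlonglongrightarrow> 0"
      using lim
    proof eventually_elim
      case (elim p)
      then have "(\<lambda>i. W p - step_kernel (r i) p) \<longlonglongrightarrow> W p - W p" by (intro tendsto_intros)
      then show ?case by (simp add: tendsto_rabs_zero)
    qed
    show "AE p in unit_square_measure. norm \<bar>W p - step_kernel (r i) p\<bar> \<le> 1" for i
    proof (rule AE_I2)
      fix p show "norm \<bar>W p - step_kernel (r i) p\<bar> \<le> 1"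
        using W_range[of p] step_kernel_range[of "r i" p] by auto
    qed
  qed (intro bm bounded_measurable_measurable W)+
  then have lim_L1: "(\<lambda>i. \<integral>p. \<bar>W p - step_kernel (r i) p\<bar> \<partial>unit_square_measure) \<longlonglongrightarrow> 0" by simp
  have "(\<lambda>i. \<integral>p. norm (deviation W (r i) p) \<partial>unit_square_measure) \<longlonglongrightarrow> 0"
  proof (rule tendsto_sandwich[OF _ _ tendsto_const lim_L1])
    show "\<forall>\<^sub>F i in sequentially. 0 \<le> (\<integral>p. norm (deviation W (r i) p) \<partial>unit_square_measure)" by simp
    show "\<forall>\<^sub>F i in sequentially. (\<integral>p. norm (deviation W (r i) p) \<partial>unit_square_measure)
        \<le> (\<integral>p. \<bar>W p - step_kernel (r i) p\<bar> \<partial>unit_square_measure)"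
      using integral_deviation_le[OF W] by (simp add: deviation_nonneg)
  qed
  moreover have "integrable unit_square_measure (deviation W (r i))" for i
    unfolding deviation_def by (intro bounded_measurable_integrable step_fun_bounded_measurable)
  ultimately obtain r' where r': "strict_mono r'"
    "AE p in unit_square_measure. (\<lambda>n. deviation W (r (r' n)) p) \<longlonglongrightarrow> 0"
    using tendsto_L1_AE_subseq[of unit_square_measure "\<lambda>i. deviation W (r i)"] by blast
  show ?thesis
  proof (rule that[of W "r \<circ> r'"])
    show "strict_mono (r \<circ> r')" using r(1) r'(1) by (rule strict_mono_o)
    show "AE p in unit_square_measure. (\<lambda>n. step_kernel ((r \<circ> r') n) p) \<longlonglongrightarrow> W p"
      using lim
    proof eventually_elim
      case (elim p)
      from LIMSEQ_subseq_LIMSEQ[OF this r'(1)] show ?case by (simp add: o_def)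
    qed
    show "AE p in unit_square_measure. (\<lambda>n. deviation W ((r \<circ> r') n) p) \<longlonglongrightarrow> 0"
      using r'(2) by simp
  qed (use W W_range in auto)
qed

end

section \<open>Densities of the step kernels and of their limit\<close>

lemma AE_PiM_unit_less_1:
  assumes "finite Q"
  shows "AE x in (\<Pi>\<^sub>M q\<in>Q. unit_interval_measure). \<forall>q\<in>Q. x q \<in> {0..<1}"
  using assms
  by (intro AE_finite_allI AE_PiM_component prob_space_unit_interval AE_unit_less_1)

lemma prob_space_PiM_unit: "prob_space (\<Pi>\<^sub>M q\<in>Q. unit_interval_measure)"
  by (rule prob_space_PiM) (rule prob_space_unit_interval)

lemma measurable_PiM_unit_pair:
  assumes "f \<in> borel_measurable unit_square_measure" "p \<in> Q" "q \<in> Q"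
  shows "(\<lambda>x. f (x p, x q)) \<in> borel_measurable (\<Pi>\<^sub>M q\<in>Q. unit_interval_measure)"
proof -
  have "(\<lambda>x. (x p, x q)) \<in> (\<Pi>\<^sub>M q\<in>Q. unit_interval_measure) \<rightarrow>\<^sub>M unit_square_measure"
    using assms(2,3) by measurable
  from measurable_compose[OF this assms(1)] show ?thesis .
qed

lemma measurable_PiM_unit_prod:
  fixes f :: "real \<times> real \<Rightarrow> real"
  assumes "f \<in> borel_measurable unit_square_measure" "s \<subseteq> Q \<times> Q"
  shows "(\<lambda>x. \<Prod>(p, q)\<in>s. f (x p, x q)) \<in> borel_measurable (\<Pi>\<^sub>M q\<in>Q. unit_interval_measure)"
  unfolding case_prod_unfold
  by (rule borel_measurable_prod) (rule measurable_PiM_unit_pair, use assms in auto)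

lemma prod_pairs_range:
  fixes f :: "real \<times> real \<Rightarrow> real"
  assumes "\<And>p. f p \<in> {0..1}"
  shows "(\<Prod>(p, q)\<in>s. f (x p, x q)) \<in> {0..1}"
  unfolding case_prod_unfold atLeastAtMost_iff
  by (intro conjI prod_nonneg prod_le_1) (use assms in \<open>simp_all\<close>)

lemma bounded_measurable_section:
  assumes "bounded_measurable f"
  shows "x \<in> {0..1} \<Longrightarrow> integrable unit_interval_measure (\<lambda>y. f (x, y))"
    and "y \<in> {0..1} \<Longrightarrow> integrable unit_interval_measure (\<lambda>x. f (x, y))"
proof -
  obtain B where B: "\<And>p. \<bar>f p\<bar> \<le> B" using assms by (auto simp: bounded_measurable_def)
  have f: "f \<in> borel_measurable unit_square_measure" using assms by (rule bounded_measurable_measurable)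
  show "integrable unit_interval_measure (\<lambda>y. f (x, y))" if "x \<in> {0..1}"
  proof (rule unit.integrable_const_bound[of _ B])
    show "(\<lambda>y. f (x, y)) \<in> borel_measurable unit_interval_measure"
      by (rule measurable_compose[OF measurable_Pair1' f]) (use that in simp)
  qed (use B in simp)
  show "integrable unit_interval_measure (\<lambda>x. f (x, y))" if "y \<in> {0..1}"
  proof (rule unit.integrable_const_bound[of _ B])
    show "(\<lambda>x. f (x, y)) \<in> borel_measurable unit_interval_measure"
      by (rule measurable_compose[OF measurable_Pair2' f]) (use that in simp)
  qed (use B in simp)
qed

context edge_limit
begin

text \<open>Almost every point of the cube lies in exactly one product of cells. There the integrand
  is the constant \<open>c\<close>, and the measure of the product is the product of the
  lengths.\<close>

lemma step_density_eq_kernel_density: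
  assumes Q: "finite Q" "s \<subseteq> Q \<times> Q"
  shows "step_density (3 ^ m) (a m) (e m) Q s
    = kernel_density Q s unit_interval_measure (\<lambda>x y. step_kernel m (x, y))"
proof -
  interpret product_sigma_finite "\<lambda>_. unit_interval_measure" ..
  let ?P = "\<Pi>\<^sub>M q\<in>Q. unit_interval_measure"
  interpret P: prob_space ?P by (rule prob_space_PiM_unit)
  let ?I = "PiE Q (\<lambda>_. {..<(3::nat) ^ m})"
  let ?\<rho> = "\<lambda>i j. e m i j / (a m i * a m j)"
  define c where "c i = (\<Prod>(p, q)\<in>s. ?\<rho> (i p) (i q))" for i
  have fin: "finite ?I" using Q by (auto intro: finite_PiE)
  have ind: "integrable unit_interval_measure (indicator (cell m i) :: real \<Rightarrow> real)" for i
    by (rule unit.integrable_const_bound[of _ 1]) auto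
  have int: "integrable ?P (\<lambda>x. \<Prod>q\<in>Q. indicator (cell m (i q)) (x q) :: real)" for i
    by (rule product_integrable_prod) (use Q ind in auto)
  have val: "(\<integral>x. (\<Prod>q\<in>Q. indicator (cell m (i q)) (x q) :: real) \<partial>?P) = (\<Prod>q\<in>Q. a m (i q))" for i
    by (subst product_integral_prod) (use Q ind integral_cell in simp_all)
  have pt: "(\<Prod>(p, q)\<in>s. step_kernel m (x p, x q))
      = (\<Sum>i\<in>?I. (\<Prod>q\<in>Q. indicator (cell m (i q)) (x q)) * c i)" if x: "\<forall>q\<in>Q. x q \<in> {0..<1}" for x
  proof -
    define k where "k = restrict (\<lambda>q. idx m (x q)) Q"
    have k: "k \<in> ?I" using x idx_less(2) by (auto simp: k_def)
    have "(\<Prod>(p, q)\<in>s. step_kernel m (x p, x q)) = c k"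
      unfolding c_def
    proof (rule prod.cong[OF refl])
      fix d assume "d \<in> s"
      then obtain p q where "d = (p, q)" "p \<in> Q" "q \<in> Q" using Q by auto
      then show "(case d of (p, q) \<Rightarrow> step_kernel m (x p, x q)) = (case d of (p, q) \<Rightarrow> ?\<rho> (k p) (k q))"
        using x by (simp add: step_kernel_def step_fun_eq k_def)
    qed
    also have "\<dots> = (\<Sum>i\<in>?I. if i = k then c i else 0)" using fin k by simp
    also have "\<dots> = (\<Sum>i\<in>?I. (\<Prod>q\<in>Q. indicator (cell m (i q)) (x q)) * c i)"
    proof (rule sum.cong[OF refl])
      fix i assume i: "i \<in> ?I"
      show "(if i = k then c i else 0) = (\<Prod>q\<in>Q. indicator (cell m (i q)) (x q)) * c i"
      proof (cases "i = k")
        case True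
        have "(\<Prod>q\<in>Q. indicator (cell m (i q)) (x q) :: real) = 1"
          using True x by (intro prod.neutral) (simp add: k_def idx_cell)
        then show ?thesis using True by simp
      next
        case False
        then obtain q where q: "q \<in> Q" "i q \<noteq> k q" using i k by (meson PiE_ext)
        then have "x q \<notin> cell m (i q)" using x by (simp add: cell_iff_idx k_def)
        then have "(\<Prod>q\<in>Q. indicator (cell m (i q)) (x q) :: real) = 0"
          using q Q by (intro prod_zero bexI[of _ q]) simp_all
        then show ?thesis using False by simp
      qed
    qed
    finally show ?thesis .
  qed
  have "kernel_density Q s unit_interval_measure (\<lambda>x y. step_kernel m (x, y))
      = (\<integral>x. (\<Sum>i\<in>?I. (\<Prod>q\<in>Q. indicator (cell m (i q)) (x q)) * c i) \<partial>?P)"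
    unfolding kernel_density_def
  proof (rule integral_cong_AE)
    show "(\<lambda>x. \<Prod>(p, q)\<in>s. step_kernel m (x p, x q)) \<in> borel_measurable ?P"
      by (rule measurable_PiM_unit_prod[OF bounded_measurable_measurable[OF step_kernel_bounded_measurable] Q(2)])
    show "(\<lambda>x. \<Sum>i\<in>?I. (\<Prod>q\<in>Q. indicator (cell m (i q)) (x q)) * c i) \<in> borel_measurable ?P"
      using int by (intro borel_measurable_sum borel_measurable_times borel_measurable_const borel_measurable_integrable)
    show "AE x in ?P. (\<Prod>(p, q)\<in>s. step_kernel m (x p, x q))
        = (\<Sum>i\<in>?I. (\<Prod>q\<in>Q. indicator (cell m (i q)) (x q)) * c i)"
      using AE_PiM_unit_less_1[OF Q(1)] by eventually_elim (rule pt)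
  qed
  also have "\<dots> = (\<Sum>i\<in>?I. (\<Prod>q\<in>Q. a m (i q)) * c i)"
    using int by (subst Bochner_Integration.integral_sum) (simp_all add: val)
  finally show ?thesis by (simp add: step_density_def c_def)
qed

lemma step_density_tendsto_kernel_density:
  assumes Q: "finite Q" "s \<subseteq> Q \<times> Q" "irrefl s"
    and W: "bounded_measurable W"
    and lim: "AE p in unit_square_measure. (\<lambda>n. step_kernel (q n) p) \<longlonglongrightarrow> W p"
  shows "(\<lambda>n. step_density (3 ^ q n) (a (q n)) (e (q n)) Q s)
    \<longlonglongrightarrow> kernel_density Q s unit_interval_measure (\<lambda>x y. W (x, y))"
  unfolding step_density_eq_kernel_density[OF Q(1,2)] kernel_density_def
proof (rule integral_dominated_convergence[where w = "\<lambda>_. 1"])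
  let ?P = "\<Pi>\<^sub>M q\<in>Q. unit_interval_measure"
  interpret P: prob_space ?P by (rule prob_space_PiM_unit)
  have fin: "finite s" using Q by (auto intro: finite_subset)
  show "(\<lambda>x. \<Prod>(p, q)\<in>s. W (x p, x q)) \<in> borel_measurable ?P"
    by (rule measurable_PiM_unit_prod[OF bounded_measurable_measurable[OF W] Q(2)])
  show "(\<lambda>x. \<Prod>(p, q')\<in>s. step_kernel (q n) (x p, x q')) \<in> borel_measurable ?P" for n
    by (rule measurable_PiM_unit_prod[OF bounded_measurable_measurable[OF step_kernel_bounded_measurable] Q(2)])
  show "integrable ?P (\<lambda>_. 1 :: real)" by simp
  have "AE x in ?P. (\<lambda>n. step_kernel (q n) (x (fst d), x (snd d))) \<longlonglongrightarrow> W (x (fst d), x (snd d))"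
    if "d \<in> s" for d
    by (rule unit.AE_PiM_pair[OF Q(1) _ _ _ lim]) (use that Q in \<open>auto simp: irrefl_def\<close>)
  then have "AE x in ?P. \<forall>d\<in>s. (\<lambda>n. step_kernel (q n) (x (fst d), x (snd d))) \<longlonglongrightarrow> W (x (fst d), x (snd d))"
    by (intro AE_finite_allI fin)
  then show "AE x in ?P. (\<lambda>n. \<Prod>(p, q')\<in>s. step_kernel (q n) (x p, x q')) \<longlonglongrightarrow> (\<Prod>(p, q')\<in>s. W (x p, x q'))"
    unfolding case_prod_unfold by eventually_elim (intro tendsto_prod, simp)
  show "AE x in ?P. norm (\<Prod>(p, q')\<in>s. step_kernel (q n) (x p, x q')) \<le> 1" for n
  proof (rule AE_I2)
    fix x
    show "norm (\<Prod>(p, q')\<in>s. step_kernel (q n) (x p, x q')) \<le> 1"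
      using prod_pairs_range[of "step_kernel (q n)" x s, OF step_kernel_range] by simp
  qed
qed

end

interpretation unit3: pair_prob_space unit_square_measure unit_interval_measure ..

text \<open>The difference of the two densities is the integral of \<open>g * (1 - h)\<close>. The
  integrand is nonnegative, so equality of the densities makes it vanish almost everywhere.\<close>

lemma AE_triple_from_densities:
  assumes W: "bounded_measurable W" "\<And>p. W p \<in> {0..1}"
    and eq: "kernel_density {0, 1, 2 :: nat} {(0, 1), (1, 2)} unit_interval_measure (\<lambda>x y. W (x, y))
      = kernel_density {0, 1, 2 :: nat} {(0, 1), (1, 2), (0, 2)} unit_interval_measure (\<lambda>x y. W (x, y))"
  shows "AE p in unit_square_measure. AE y in unit_interval_measure.
    W (fst p, y) = 0 \<or> W (y, snd p) = 0 \<or> W p = 1"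
proof -
  let ?Q = "{0, 1, 2 :: nat}"
  let ?P = "\<Pi>\<^sub>M q\<in>?Q. unit_interval_measure"
  interpret P: prob_space ?P by (rule prob_space_PiM_unit)
  note meas = measurable_PiM_unit_pair[OF bounded_measurable_measurable[OF W(1)], of _ ?Q]
  define g where "g x = W (x 0, x 1) * W (x 1, x 2)" for x :: "nat \<Rightarrow> real"
  define h where "h x = W (x 0, x 2)" for x :: "nat \<Rightarrow> real"
  have gm: "g \<in> borel_measurable ?P" unfolding g_def by (intro borel_measurable_times meas) auto
  have hm: "h \<in> borel_measurable ?P" unfolding h_def by (rule meas) auto
  have g: "g x \<in> {0..1}" and h: "h x \<in> {0..1}" for x
    using W(2)[of "(x 0, x 1)"] W(2)[of "(x 1, x 2)"] W(2)[of "(x 0, x 2)"]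
    by (auto simp: g_def h_def intro: mult_le_one)
  have gh: "g x * h x \<in> {0..1}" for x using g[of x] h[of x] by (auto intro: mult_le_one)
  have bounded: "integrable ?P f" if "f \<in> borel_measurable ?P" "\<And>x. f x \<in> {0..1}"
    for f :: "(nat \<Rightarrow> real) \<Rightarrow> real"
    by (rule P.integrable_const_bound[of _ 1, OF AE_I2 that(1)]) (use that(2) in simp)
  have int: "integrable ?P g" "integrable ?P (\<lambda>x. g x * h x)"
    by (rule bounded, fact gm, rule g) (rule bounded, rule borel_measurable_times[OF gm hm], rule gh)
  have "(\<integral>x. g x - g x * h x \<partial>?P) = (\<integral>x. g x \<partial>?P) - (\<integral>x. g x * h x \<partial>?P)"
    by (rule Bochner_Integration.integral_diff[OF int])
  also have "\<dots> = 0"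
    using eq by (simp add: kernel_density_def g_def h_def mult.assoc)
  finally have "(\<integral>x. g x - g x * h x \<partial>?P) = 0" .
  moreover have "AE x in ?P. 0 \<le> g x - g x * h x"
    using g h by (intro AE_I2) (auto simp: mult_left_le)
  ultimately have "AE x in ?P. g x - g x * h x = 0"
    using integral_nonneg_eq_0_iff_AE[of ?P "\<lambda>x. g x - g x * h x"] int by simp
  then have "AE x in distr (unit_square_measure \<Otimes>\<^sub>M unit_interval_measure) ?P
      (\<lambda>((x, z), y). \<lambda>q\<in>?Q. if q = 0 then x else if q = 1 then y else z). g x - g x * h x = 0"
    by (subst (asm) unit.PiM_three_eq_distr) simp_all
  moreover have "(\<lambda>((x, z), y). \<lambda>q\<in>?Q. if q = 0 then x else if q = 1 then y else z)
      \<in> unit_square_measure \<Otimes>\<^sub>M unit_interval_measure \<rightarrow>\<^sub>M ?P"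
    unfolding case_prod_unfold by measurable
  ultimately have "AE p in unit_square_measure \<Otimes>\<^sub>M unit_interval_measure.
      (\<lambda>x. g x - g x * h x = 0) ((\<lambda>((x, z), y). \<lambda>q\<in>?Q. if q = 0 then x else if q = 1 then y else z) p)"
    by (rule AE_distrD[rotated])
  then have "AE p in unit_square_measure \<Otimes>\<^sub>M unit_interval_measure.
      W (fst (fst p), snd p) = 0 \<or> W (snd p, snd (fst p)) = 0 \<or> W (fst p) = 1"
    by eventually_elim (auto simp: g_def h_def case_prod_unfold)
  from unit3.AE_pair[OF this] show ?thesis by simp
qed

context edge_limit
begin

text \<open>The triple condition integrated over a product of three cells; after division by the
  three lengths it bounds an average of \<open>1 - W\<close> by two averages of the zero set. In
  this form no exceptional null set is left.\<close>

lemma block_integral_zero_set_le: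
  assumes W: "bounded_measurable W" "\<And>p. W p \<in> {0..1}"
    and AE: "AE p in unit_square_measure. AE y in unit_interval_measure.
      W (fst p, y) = 0 \<or> W (y, snd p) = 0 \<or> W p = 1"
  defines "Z \<equiv> \<lambda>p. of_bool (W p = 0)"
  shows "a m j * block_integral m i k (\<lambda>p. 1 - W p)
    \<le> a m k * block_integral m i j Z + a m i * block_integral m j k Z"
proof -
  let ?u = unit_interval_measure
  let ?c = "\<lambda>i. indicator (cell m i) :: real \<Rightarrow> real"
  have Z: "bounded_measurable Z"
  proof (rule bounded_measurableI[of _ 1])
    have "(\<lambda>p. indicator {0::real} (W p) :: real) \<in> borel_measurable unit_square_measure"
      by (rule measurable_compose[OF bounded_measurable_measurable[OF W(1)] borel_measurable_indicator]) simp
    moreover have "Z = (\<lambda>p. indicator {0::real} (W p))" by (auto simp: Z_def indicator_def)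
    ultimately show "Z \<in> borel_measurable unit_square_measure" by simp
  qed (simp add: Z_def)
  note bm = bounded_measurable_intros block_bounded_measurable W(1) Z
  \<comment> \<open>\<open>G\<close> and \<open>H\<close> have the middle point already integrated
    out, so that the remaining inequality lives on the square of the outer points.\<close>
  define G where "G x = (\<integral>y. block m i j (x, y) * Z (x, y) \<partial>?u)" for x
  define H where "H z = (\<integral>y. block m j k (y, z) * Z (y, z) \<partial>?u)" for z
  have bZ: "integrable unit_square_measure (\<lambda>p. block m i j p * Z p)" for i j
    by (intro bounded_measurable_integrable bm)
  have G: "integrable ?u G" "(\<integral>x. G x \<partial>?u) = block_integral m i j Z"
    unfolding G_def block_integral_def
    using unit2.integrable_fst'[OF bZ] unit2.integral_fst'[OF bZ] by simp_all
  have H: "integrable ?u H" "(\<integral>z. H z \<partial>?u) = block_integral m j k Z"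
    unfolding H_def block_integral_def
    using unit2.integrable_snd[of "\<lambda>y z. block m j k (y, z) * Z (y, z)"]
      unit2.integral_snd[of "\<lambda>y z. block m j k (y, z) * Z (y, z)"] bZ
    by (simp_all add: case_prod_unfold)
  have ind: "integrable ?u (?c i)" for i
    by (rule unit.integrable_const_bound[of _ 1]) auto
  have [measurable]: "G \<in> borel_measurable ?u" "H \<in> borel_measurable ?u"
    using G(1) H(1) by (simp_all add: borel_measurable_integrable)
  have int1: "integrable unit_square_measure (\<lambda>p. G (fst p) * ?c k (snd p))"
    and int2: "integrable unit_square_measure (\<lambda>p. ?c i (fst p) * H (snd p))"
    using G(1) H(1) ind by (auto intro!: unit2.Fubini_integrable simp: abs_mult)
  have "a m j * block_integral m i k (\<lambda>p. 1 - W p)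
      = (\<integral>p. a m j * (block m i k p * (1 - W p)) \<partial>unit_square_measure)"
    by (simp add: block_integral_def)
  also have "\<dots> \<le> (\<integral>p. G (fst p) * ?c k (snd p) + ?c i (fst p) * H (snd p) \<partial>unit_square_measure)"
  proof (rule integral_mono_AE)
    show "integrable unit_square_measure (\<lambda>p. a m j * (block m i k p * (1 - W p)))"
      by (intro bounded_measurable_integrable bm)
    show "integrable unit_square_measure (\<lambda>p. G (fst p) * ?c k (snd p) + ?c i (fst p) * H (snd p))"
      by (rule Bochner_Integration.integrable_add[OF int1 int2])
    have "AE p in unit_square_measure. p \<in> {0..1} \<times> {0..1}"
      using AE_space[of unit_square_measure] by (simp add: space_pair_measure)
    with AE show "AE p in unit_square_measure. a m j * (block m i k p * (1 - W p))
        \<le> G (fst p) * ?c k (snd p) + ?c i (fst p) * H (snd p)"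
    proof eventually_elim
      case (elim p)
      then obtain x z where p: "p = (x, z)" and xz: "x \<in> {0..1}" "z \<in> {0..1}" by auto
      have i1: "integrable ?u (\<lambda>y. block m i j (x, y) * Z (x, y))"
        using xz by (intro bounded_measurable_section(1)[where f = "\<lambda>p. block m i j p * Z p"] bm)
      have i2: "integrable ?u (\<lambda>y. block m j k (y, z) * Z (y, z))"
        using xz by (intro bounded_measurable_section(2)[where f = "\<lambda>p. block m j k p * Z p"] bm)
      have "a m j * (block m i k p * (1 - W p)) = (\<integral>y. ?c j y * (block m i k p * (1 - W p)) \<partial>?u)"
        using integral_cell[of m j] by simp
      also have "\<dots> \<le> (\<integral>y. block m i j (x, y) * Z (x, y) * ?c k z + ?c i x * (block m j k (y, z) * Z (y, z)) \<partial>?u)"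
      proof (rule integral_mono_AE)
        show "integrable ?u (\<lambda>y. ?c j y * (block m i k p * (1 - W p)))"
          by (rule integrable_mult_left) (rule ind)
        show "integrable ?u (\<lambda>y. block m i j (x, y) * Z (x, y) * ?c k z + ?c i x * (block m j k (y, z) * Z (y, z)))"
          by (intro Bochner_Integration.integrable_add integrable_mult_left integrable_mult_right i1 i2)
        show "AE y in ?u. ?c j y * (block m i k p * (1 - W p))
            \<le> block m i j (x, y) * Z (x, y) * ?c k z + ?c i x * (block m j k (y, z) * Z (y, z))"
          using elim(1)
        proof eventually_elim
          case (elim y)
          \<comment> \<open>If neither of the two values vanishes, then \<open>W p = 1\<close> and
            the left side is 0; otherwise the right side is at least 1.\<close>
          have "1 - W p \<le> Z (x, y) + Z (y, z)"
            using elim W(2)[of p] by (auto simp: p Z_def)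
          then have "(?c i x * ?c j y * ?c k z) * (1 - W p) \<le> (?c i x * ?c j y * ?c k z) * (Z (x, y) + Z (y, z))"
            by (intro mult_left_mono) simp_all
          then show ?case by (simp add: block_def p algebra_simps)
        qed
      qed
      also have "\<dots> = G x * ?c k z + ?c i x * H z"
        unfolding G_def H_def
        by (subst Bochner_Integration.integral_add)
          (simp_all add: i1 i2)
      finally show ?case by (simp add: p)
    qed
  qed
  also have "\<dots> = block_integral m i j Z * a m k + a m i * block_integral m j k Z"
    using integral_fst_mult_snd[OF G(1) ind, of k] integral_fst_mult_snd[OF ind H(1), of i]
    unfolding G(2) H(2) integral_cell by (simp add: Bochner_Integration.integral_add[OF int1 int2])
  finally show ?thesis by (simp add: mult.commute)
qed

end

section \<open>From almost everywhere to everywhere\<close>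

lemma borel_measurable_unit_square_fst: "fst \<in> borel_measurable unit_square_measure"
  and borel_measurable_unit_square_snd: "snd \<in> borel_measurable unit_square_measure"
  using measurable_compose[OF measurable_fst[of unit_interval_measure unit_interval_measure] measurable_unit[of "\<lambda>x. x"]]
    measurable_compose[OF measurable_snd[of unit_interval_measure unit_interval_measure] measurable_unit[of "\<lambda>x. x"]]
  by simp_all

locale edge_limit_kernel = edge_limit +
  fixes W :: "real \<times> real \<Rightarrow> real" and q :: "nat \<Rightarrow> nat"
  assumes W_bounded_measurable: "bounded_measurable W"
    and W_range: "W p \<in> {0..1}"
    and q_mono: "strict_mono q"
    and step_kernel_AE: "AE p in unit_square_measure. (\<lambda>n. step_kernel (q n) p) \<longlonglongrightarrow> W p"
    and deviation_AE: "AE p in unit_square_measure. (\<lambda>n. deviation W (q n) p) \<longlonglongrightarrow> 0"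
    and triple_AE: "AE p in unit_square_measure. AE y in unit_interval_measure.
      W (fst p, y) = 0 \<or> W (y, snd p) = 0 \<or> W p = 1"
begin

text \<open>The block integrals of the step kernels are eventually constant along \<open>q\<close>,
  and dominated convergence carries them over to \<open>W\<close>.\<close>

lemma block_integral_W: "block_integral m i j W = e m i j"
proof (rule LIMSEQ_unique)
  show "(\<lambda>n. block_integral m i j (step_kernel (q n))) \<longlonglongrightarrow> block_integral m i j W"
    unfolding block_integral_def
  proof (rule integral_dominated_convergence[where w = "\<lambda>_. 1"])
    show "AE p in unit_square_measure. (\<lambda>n. block m i j p * step_kernel (q n) p) \<longlonglongrightarrow> block m i j p * W p"
      using step_kernel_AE by eventually_elim (intro tendsto_intros)
    show "AE p in unit_square_measure. norm (block m i j p * step_kernel (q n) p) \<le> 1" for n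
    proof (rule AE_I2)
      fix p show "norm (block m i j p * step_kernel (q n) p) \<le> 1"
        using block_range[of m i j p] step_kernel_range[of "q n" p] by (auto simp: abs_mult intro: mult_le_one)
    qed
  qed (intro bounded_measurable_integrable bounded_measurable_measurable bounded_measurable_intros
      block_bounded_measurable W_bounded_measurable step_kernel_bounded_measurable)+
  have "\<forall>\<^sub>F n in sequentially. block_integral m i j (step_kernel (q n)) = e m i j"
    using eventually_ge_at_top[of m]
  proof eventually_elim
    case (elim n)
    then have "m \<le> q n" using seq_suble[OF q_mono, of n] by simp
    then show ?case by (rule block_integral_step_kernel)
  qed
  then show "(\<lambda>n. block_integral m i j (step_kernel (q n))) \<longlonglongrightarrow> e m i j" by (rule tendsto_eventually)
qed

text \<open>On [0,1) the conditions depend on \<open>x\<close> and \<open>y\<close> only through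
  their cells, and \<open>W\<close> enters only through averages. So goodness can be proved at a
  prescribed pair of points, even one lying in a null set.\<close>

definition good :: "real \<Rightarrow> real \<Rightarrow> bool" where
  "good x y \<longleftrightarrow> x \<in> {0..<1} \<and> y \<in> {0..<1} \<and> (\<lambda>n. deviation W (q n) (x, y)) \<longlonglongrightarrow> 0 \<and>
     (\<exists>l>0. (\<lambda>n. step_kernel (q n) (x, y)) \<longlonglongrightarrow> l)"

definition zero_set :: "real \<times> real \<Rightarrow> real" where
  "zero_set p = of_bool (W p = 0)"

lemma zero_set_bounded_measurable: "bounded_measurable zero_set"
proof (rule bounded_measurableI[of _ 1])
  have "(\<lambda>p. indicator {0::real} (W p) :: real) \<in> borel_measurable unit_square_measure"
    by (rule measurable_compose[OF bounded_measurable_measurable[OF W_bounded_measurable] borel_measurable_indicator]) simp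
  moreover have "zero_set = (\<lambda>p. indicator {0::real} (W p))" by (auto simp: zero_set_def indicator_def)
  ultimately show "zero_set \<in> borel_measurable unit_square_measure" by simp
qed (simp add: zero_set_def)

lemma step_kernel_eq:
  "x \<in> {0..<1} \<Longrightarrow> y \<in> {0..<1} \<Longrightarrow>
    step_kernel m (x, y) = e m (idx m x) (idx m y) / (a m (idx m x) * a m (idx m y))"
  by (simp add: step_kernel_def step_fun_eq)

lemma deviation_eq:
  "x \<in> {0..<1} \<Longrightarrow> y \<in> {0..<1} \<Longrightarrow> deviation W m (x, y) =
    block_integral m (idx m x) (idx m y) (\<lambda>p. \<bar>W p - step_kernel m p\<bar>) / (a m (idx m x) * a m (idx m y))"
  by (simp add: deviation_def step_fun_eq)

lemma step_kernel_on_block: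
  assumes "x \<in> {0..<1}" "y \<in> {0..<1}" "block m (idx m x) (idx m y) p \<noteq> 0"
  shows "step_kernel m p = step_kernel m (x, y)"
proof -
  have p: "fst p \<in> {0..<1}" "snd p \<in> {0..<1}" using assms(3) block_outside by blast+
  then show ?thesis using assms by (auto simp: block_eq step_kernel_def step_fun_eq)
qed

definition avg :: "nat \<Rightarrow> real \<Rightarrow> real \<Rightarrow> (real \<times> real \<Rightarrow> real) \<Rightarrow> real" where
  "avg m x y f = block_integral m (idx m x) (idx m y) f / (a m (idx m x) * a m (idx m y))"

text \<open>
  On the zero set of \<open>W\<close> the integrand of the deviation equals the value of the step kernel, which stays
  bounded away from \<open>0\<close> at a good point.
\<close>

lemma avg_zero_set_tendsto:
  assumes "good x y"
  shows "(\<lambda>n. avg (q n) x y zero_set) \<longlonglongrightarrow> 0"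
proof -
  from assms obtain l where xy: "x \<in> {0..<1}" "y \<in> {0..<1}"
    and dev: "(\<lambda>n. deviation W (q n) (x, y)) \<longlonglongrightarrow> 0"
    and l: "l > 0" "(\<lambda>n. step_kernel (q n) (x, y)) \<longlonglongrightarrow> l"
    by (auto simp: good_def)
  have le: "avg m x y zero_set * step_kernel m (x, y) \<le> deviation W m (x, y)" for m
  proof -
    have "block_integral m (idx m x) (idx m y) (\<lambda>p. step_kernel m (x, y) * zero_set p)
        \<le> block_integral m (idx m x) (idx m y) (\<lambda>p. \<bar>W p - step_kernel m p\<bar>)"
    proof (rule block_integral_mono)
      fix p assume "block m (idx m x) (idx m y) p \<noteq> 0"
      then have "step_kernel m p = step_kernel m (x, y)" by (rule step_kernel_on_block[OF xy])
      then show "step_kernel m (x, y) * zero_set p \<le> \<bar>W p - step_kernel m p\<bar>"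
        using step_kernel_range[of m "(x, y)"] by (simp add: zero_set_def)
    qed (intro bounded_measurable_intros W_bounded_measurable zero_set_bounded_measurable
        step_kernel_bounded_measurable)+
    then have "step_kernel m (x, y) * block_integral m (idx m x) (idx m y) zero_set
        / (a m (idx m x) * a m (idx m y)) \<le> deviation W m (x, y)"
      unfolding block_integral_cmult deviation_eq[OF xy] using a_nonneg by (intro divide_right_mono) auto
    then show ?thesis by (simp add: avg_def mult.commute)
  qed
  have ge: "0 \<le> avg m x y zero_set" for m
    unfolding avg_def using a_nonneg by (intro divide_nonneg_nonneg block_integral_nonneg) (auto simp: zero_set_def)
  have "(\<lambda>n. deviation W (q n) (x, y) / step_kernel (q n) (x, y)) \<longlonglongrightarrow> 0 / l"
    using l by (intro tendsto_divide dev) auto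
  then have "(\<lambda>n. deviation W (q n) (x, y) / step_kernel (q n) (x, y)) \<longlonglongrightarrow> 0" by simp
  moreover have "\<forall>\<^sub>F n in sequentially. 0 < step_kernel (q n) (x, y)"
    using l by (rule order_tendstoD(1)[rotated])
  then have "\<forall>\<^sub>F n in sequentially. norm (avg (q n) x y zero_set)
      \<le> deviation W (q n) (x, y) / step_kernel (q n) (x, y)"
  proof eventually_elim
    case (elim n)
    then show ?case using ge[of "q n"] le[of "q n"] by (simp add: pos_le_divide_eq)
  qed
  ultimately show ?thesis by (rule Lim_null_comparison[rotated])
qed

text \<open>Near good pairs the zero set has vanishing density, so the averages \<open>A\<close> of
  \<open>1 - W\<close> around \<open>(x, z)\<close> tend to 0. Both conclusions are then estimates
  in terms of \<open>A\<close>.\<close>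

lemma good_trans:
  assumes "good x y" "good y z"
  shows "(\<lambda>n. step_kernel (q n) (x, z)) \<longlonglongrightarrow> 1" "(\<lambda>n. deviation W (q n) (x, z)) \<longlonglongrightarrow> 0"
proof -
  have xyz: "x \<in> {0..<1}" "y \<in> {0..<1}" "z \<in> {0..<1}" using assms by (auto simp: good_def)
  define A where "A m = avg m x z (\<lambda>p. 1 - W p)" for m
  note pos = a_idx_pos[OF xyz(1)] a_idx_pos[OF xyz(2)] a_idx_pos[OF xyz(3)]
  note bm = bounded_measurable_intros W_bounded_measurable step_kernel_bounded_measurable
  have A_ge: "0 \<le> A m" for m
    unfolding A_def avg_def using a_nonneg W_range
    by (intro divide_nonneg_nonneg block_integral_nonneg) auto
  have A_le: "A m \<le> avg m x y zero_set + avg m y z zero_set" for m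
  proof -
    let ?i = "idx m x" and ?j = "idx m y" and ?k = "idx m z"
    have "a m ?j * block_integral m ?i ?k (\<lambda>p. 1 - W p)
        \<le> a m ?k * block_integral m ?i ?j zero_set + a m ?i * block_integral m ?j ?k zero_set"
      using block_integral_zero_set_le[OF W_bounded_measurable W_range triple_AE, of m ?j ?i ?k]
      by (simp add: zero_set_def[abs_def])
    then have "(a m ?j * block_integral m ?i ?k (\<lambda>p. 1 - W p)) / (a m ?i * a m ?j * a m ?k)
        \<le> (a m ?k * block_integral m ?i ?j zero_set + a m ?i * block_integral m ?j ?k zero_set)
          / (a m ?i * a m ?j * a m ?k)"
      using a_nonneg by (intro divide_right_mono) auto
    then show ?thesis
      using pos[of m] by (simp add: A_def avg_def add_divide_distrib)
  qed
  have A: "(\<lambda>n. A (q n)) \<longlonglongrightarrow> 0"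
  proof (rule tendsto_sandwich[OF _ _ tendsto_const])
    have "(\<lambda>n. avg (q n) x y zero_set + avg (q n) y z zero_set) \<longlonglongrightarrow> 0 + 0"
      by (intro tendsto_add avg_zero_set_tendsto assms)
    then show "(\<lambda>n. avg (q n) x y zero_set + avg (q n) y z zero_set) \<longlonglongrightarrow> 0" by simp
  qed (use A_ge A_le in auto)
  have sk: "step_kernel m (x, z) = 1 - A m" for m
  proof -
    have "block_integral m (idx m x) (idx m z) (\<lambda>p. 1 - W p)
        = a m (idx m x) * a m (idx m z) - e m (idx m x) (idx m z)"
      by (subst block_integral_diff) (intro bm, intro bm, simp add: block_integral_1 block_integral_W)
    then show ?thesis
      using pos[of m] by (simp add: A_def avg_def step_kernel_eq[OF xyz(1,3)] diff_divide_distrib)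
  qed
  have "(\<lambda>n. 1 - A (q n)) \<longlonglongrightarrow> 1 - 0" by (intro tendsto_intros A)
  then show "(\<lambda>n. step_kernel (q n) (x, z)) \<longlonglongrightarrow> 1" by (simp add: sk)
  \<comment> \<open>On the block the step kernel is \<open>1 - A m\<close>, so the triangle
    inequality through the value 1 bounds the integrand by \<open>(1 - W p) + A m\<close>, whose
    average is \<open>2 * A m\<close>.\<close>
  have dev_le: "deviation W m (x, z) \<le> 2 * A m" for m
  proof -
    have "block_integral m (idx m x) (idx m z) (\<lambda>p. \<bar>W p - step_kernel m p\<bar>)
        \<le> block_integral m (idx m x) (idx m z) (\<lambda>p. (1 - W p) + A m * 1)"
    proof (rule block_integral_mono)
      fix p assume "block m (idx m x) (idx m z) p \<noteq> 0"
      then have "step_kernel m p = 1 - A m" using step_kernel_on_block[OF xyz(1,3)] sk by simp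
      then show "\<bar>W p - step_kernel m p\<bar> \<le> (1 - W p) + A m * 1"
        using W_range[of p] A_ge[of m] by auto
    qed (intro bm)+
    also have "\<dots> = block_integral m (idx m x) (idx m z) (\<lambda>p. 1 - W p)
        + A m * (a m (idx m x) * a m (idx m z))"
      by (subst block_integral_add) (intro bm, intro bm, simp only: block_integral_cmult block_integral_1)
    finally have "deviation W m (x, z) \<le> (block_integral m (idx m x) (idx m z) (\<lambda>p. 1 - W p)
        + A m * (a m (idx m x) * a m (idx m z))) / (a m (idx m x) * a m (idx m z))"
      unfolding deviation_eq[OF xyz(1,3)] using a_nonneg by (intro divide_right_mono) auto
    also have "\<dots> = 2 * A m"
      using pos[of m] by (simp add: A_def avg_def add_divide_distrib)
    finally show ?thesis .
  qed
  show "(\<lambda>n. deviation W (q n) (x, z)) \<longlonglongrightarrow> 0"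
  proof (rule tendsto_sandwich[OF _ _ tendsto_const])
    have "(\<lambda>n. 2 * A (q n)) \<longlonglongrightarrow> 2 * 0" by (intro tendsto_intros A)
    then show "(\<lambda>n. 2 * A (q n)) \<longlonglongrightarrow> 0" by simp
  qed (use deviation_nonneg dev_le in auto)
qed

text \<open>Composing \<open>good x x\<close> with itself would force the step kernels at
  \<open>(x, x)\<close> to tend to 1, but on diagonal blocks they are at most 1/2.\<close>

lemma not_good_refl: "\<not> good x x"
proof
  assume g: "good x x"
  then have x: "x \<in> {0..<1}" by (simp add: good_def)
  have "step_kernel m (x, x) \<le> 1 / 2" for m
    using e_diag[of m "idx m x"] a_idx_pos[OF x, of m]
    by (simp add: step_kernel_eq[OF x x] divide_simps power2_eq_square)
  then have "1 \<le> (1 / 2 :: real)"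
    by (intro LIMSEQ_le_const2[OF good_trans(1)[OF g g]]) auto
  then show False by simp
qed

text \<open>
  If \<open>y \<le> x\<close>, the step kernels vanish at \<open>(x, y)\<close> as soon as some level separates \<open>x\<close> from \<open>y\<close>; if no
  level does, then \<open>(x, y)\<close> and \<open>(x, x)\<close> are indistinguishable.
\<close>

lemma good_less:
  assumes "good x y"
  shows "x < y"
proof (rule ccontr)
  assume "\<not> x < y"
  then have yx: "y \<le> x" by simp
  from assms obtain l where xy: "x \<in> {0..<1}" "y \<in> {0..<1}"
    and l: "l > 0" "(\<lambda>n. step_kernel (q n) (x, y)) \<longlonglongrightarrow> l"
    by (auto simp: good_def)
  have same: "idx (q n) y = idx (q n) x" for n
  proof (rule ccontr)
    assume ne: "idx (q n) y \<noteq> idx (q n) x"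
    have "step_kernel (q k) (x, y) = 0" if "k \<ge> n" for k
    proof -
      have "q n \<le> q k" using q_mono that by (simp add: strict_mono_less_eq)
      then have "idx (q k) y \<noteq> idx (q k) x" using ne idx_eq_mono[OF xy(2,1)] by blast
      then have "idx (q k) y < idx (q k) x" using idx_mono[OF yx xy(1), of "q k"] by simp
      then show ?thesis by (simp add: step_kernel_eq[OF xy] e_order)
    qed
    then have "\<forall>\<^sub>F k in sequentially. step_kernel (q k) (x, y) = 0"
      by (intro eventually_sequentiallyI[of n])
    then have "(\<lambda>k. step_kernel (q k) (x, y)) \<longlonglongrightarrow> 0" by (rule tendsto_eventually)
    then show False using l LIMSEQ_unique by fastforce
  qed
  have "step_kernel (q n) (x, x) = step_kernel (q n) (x, y)"
    "deviation W (q n) (x, x) = deviation W (q n) (x, y)" for n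
    by (simp_all add: step_kernel_eq[OF xy(1,1)] step_kernel_eq[OF xy] deviation_eq[OF xy(1,1)] deviation_eq[OF xy] same)
  then have "good x x" using assms by (simp add: good_def)
  then show False using not_good_refl by blast
qed

text \<open>The value is the limit of the step kernels, not \<open>W\<close> itself, because
  \<open>good_trans\<close> controls that limit at every point.\<close>

definition regular_kernel :: "real \<Rightarrow> real \<Rightarrow> real" where
  "regular_kernel x y = (if good x y then lim (\<lambda>n. step_kernel (q n) (x, y)) else 0)"

lemma regular_kernel_eqI:
  assumes "good x y" "(\<lambda>n. step_kernel (q n) (x, y)) \<longlonglongrightarrow> l"
  shows "regular_kernel x y = l"
  using assms limI by (simp add: regular_kernel_def)

lemma regular_kernel_range: "regular_kernel x y \<in> {0..1}"
proof (cases "good x y")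
  case True
  then obtain l where l: "(\<lambda>n. step_kernel (q n) (x, y)) \<longlonglongrightarrow> l" by (auto simp: good_def)
  have "l \<in> {0..1}"
    by (rule closed_sequentially[OF _ _ l]) (use step_kernel_range in auto)
  then show ?thesis using regular_kernel_eqI[OF True l] by simp
qed (simp add: regular_kernel_def)

lemma regular_kernel_pos: "0 < regular_kernel x y \<Longrightarrow> good x y"
  by (auto simp: regular_kernel_def split: if_splits)

lemma good_sets: "{p \<in> space unit_square_measure. good (fst p) (snd p)} \<in> sets unit_square_measure"
proof -
  \<comment> \<open>Convergence to a given or to some positive value is rewritten through
    \<open>Cauchy\<close> and \<open>lim\<close>, both of which are measurable conditions.\<close>
  have conv_iff: "f \<longlonglongrightarrow> c \<longleftrightarrow> Cauchy f \<and> lim f = c" for f :: "nat \<Rightarrow> real" and c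
    by (metis Cauchy_convergent_iff convergentI convergent_LIMSEQ_iff limI)
  have pos_iff: "(\<exists>l>0. f \<longlonglongrightarrow> l) \<longleftrightarrow> Cauchy f \<and> 0 < lim f" for f :: "nat \<Rightarrow> real"
    using conv_iff by auto
  have [measurable]: "step_kernel (q n) \<in> borel_measurable unit_square_measure"
    "deviation W (q n) \<in> borel_measurable unit_square_measure" for n
    unfolding deviation_def
    by (intro bounded_measurable_measurable step_kernel_bounded_measurable step_fun_bounded_measurable)+
  have [measurable]: "(\<lambda>p. lim (\<lambda>n. step_kernel (q n) p)) \<in> borel_measurable unit_square_measure"
    "(\<lambda>p. lim (\<lambda>n. deviation W (q n) p)) \<in> borel_measurable unit_square_measure"
    by (rule borel_measurable_lim_metric, measurable)+
  have [measurable]: "{p \<in> space unit_square_measure. Cauchy (\<lambda>n. step_kernel (q n) p)} \<in> sets unit_square_measure"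
    "{p \<in> space unit_square_measure. Cauchy (\<lambda>n. deviation W (q n) p)} \<in> sets unit_square_measure"
    by (rule sets_Collect_Cauchy, measurable)+
  note [measurable] = borel_measurable_unit_square_fst borel_measurable_unit_square_snd
  have "{p \<in> space unit_square_measure. good (fst p) (snd p)} =
    {p \<in> space unit_square_measure. 0 \<le> fst p \<and> fst p < 1} \<inter> {p \<in> space unit_square_measure. 0 \<le> snd p \<and> snd p < 1}
    \<inter> ({p \<in> space unit_square_measure. Cauchy (\<lambda>n. deviation W (q n) p)}
      \<inter> {p \<in> space unit_square_measure. lim (\<lambda>n. deviation W (q n) p) = 0})
    \<inter> ({p \<in> space unit_square_measure. Cauchy (\<lambda>n. step_kernel (q n) p)}
      \<inter> {p \<in> space unit_square_measure. 0 < lim (\<lambda>n. step_kernel (q n) p)})"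
    by (auto simp: good_def conv_iff pos_iff)
  also have "\<dots> \<in> sets unit_square_measure"
    by (intro sets.Int) measurable
  finally show ?thesis .
qed

lemma regular_kernel_bounded_measurable: "bounded_measurable (\<lambda>p. regular_kernel (fst p) (snd p))"
proof (rule bounded_measurableI[of _ 1])
  have "(\<lambda>p. lim (\<lambda>n. step_kernel (q n) p)) \<in> borel_measurable unit_square_measure"
    by (intro borel_measurable_lim_metric bounded_measurable_measurable step_kernel_bounded_measurable)
  then show "(\<lambda>p. regular_kernel (fst p) (snd p)) \<in> borel_measurable unit_square_measure"
    unfolding regular_kernel_def using good_sets by (intro measurable_If) simp_all
  show "\<bar>regular_kernel (fst p) (snd p)\<bar> \<le> 1" for p
    using regular_kernel_range[of "fst p" "snd p"] by simp
qed

text \<open>Where both almost everywhere statements hold, a point is either good or has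
  \<open>W p = 0\<close>: a positive limit forces it into the half-open square, where the step
  kernels do not vanish identically.\<close>

lemma step_kernel_AE_regular:
  "AE p in unit_square_measure. (\<lambda>n. step_kernel (q n) p) \<longlonglongrightarrow> regular_kernel (fst p) (snd p)"
  using step_kernel_AE deviation_AE
proof eventually_elim
  case (elim p)
  obtain x y where p: "p = (x, y)" by force
  show ?case
  proof (cases "good x y")
    case True
    then show ?thesis using regular_kernel_eqI[OF True] elim by (simp add: p)
  next
    case False
    have "W p = 0"
    proof (rule ccontr)
      assume ne: "W p \<noteq> 0"
      have "\<not> (\<forall>n. step_kernel (q n) p = 0)"
      proof
        assume "\<forall>n. step_kernel (q n) p = 0"
        then show False using elim(1) ne by (simp add: LIMSEQ_const_iff)
      qed
      then have "x \<in> {0..<1} \<and> y \<in> {0..<1}"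
        using step_fun_outside[of p] by (auto simp: p step_kernel_def)
      moreover have "0 < W p" using ne W_range[of p] by simp
      ultimately have "good x y"
        unfolding good_def using elim unfolding p by blast
      then show False using False by contradiction
    qed
    moreover have "regular_kernel (fst p) (snd p) = 0" using False by (simp add: p regular_kernel_def)
    ultimately show ?thesis using elim(1) by (simp only:)
  qed
qed

lemma poset_kernel_regular: "poset_kernel unit_interval_measure unit_interval_less regular_kernel"
proof
  note [measurable] = borel_measurable_unit_square_fst borel_measurable_unit_square_snd
  have "unit_interval_less = {p \<in> space unit_square_measure. fst p < snd p}"
    by (auto simp: unit_interval_less_def space_pair_measure)
  also have "\<dots> \<in> sets unit_square_measure" by measurable
  finally show "unit_interval_less \<in> sets unit_square_measure" .
  show "trans unit_interval_less" "irrefl unit_interval_less"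
    by (auto simp: unit_interval_less_def irrefl_def intro!: transI)
  show "(\<lambda>(x, y). regular_kernel x y) \<in> borel_measurable unit_square_measure"
    using bounded_measurable_measurable[OF regular_kernel_bounded_measurable] by (simp add: case_prod_unfold)
  show "regular_kernel x y \<in> {0..1}" for x y by (rule regular_kernel_range)
  show "(x, y) \<in> unit_interval_less" if "regular_kernel x y > 0" for x y
    using good_less[OF regular_kernel_pos[OF that]] regular_kernel_pos[OF that]
    by (auto simp: good_def unit_interval_less_def)
  show "regular_kernel x z = 1" if "regular_kernel x y > 0" "regular_kernel y z > 0" for x y z
  proof -
    note g = that[THEN regular_kernel_pos]
    have "good x z" using g good_trans[OF g] unfolding good_def by (auto intro: exI[of _ 1])
    then show ?thesis using good_trans(1)[OF g] by (rule regular_kernel_eqI)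
  qed
qed

end

theorem theorem1p7:
  fixes P :: "nat \<Rightarrow> 'a set" and r :: "nat \<Rightarrow> 'a rel"
  assumes "\<And>n. finite_poset (P n) (r n)"
    and "poset_convergent P r"
  shows "\<exists>U. poset_kernel unit_interval_measure unit_interval_less U \<and>
           (\<forall>(Q :: nat set) s. finite_poset Q s \<longrightarrow>
              (\<lambda>n. poset_density Q s (P n) (r n))
                \<longlonglongrightarrow> kernel_density Q s unit_interval_measure U)"
proof -
  have tr: "trans (r n)" for n using assms(1)[of n] by (simp add: finite_poset_def)
  have inf: "filterlim (\<lambda>n. card (P n)) at_top sequentially"
    using assms(2) by (simp add: poset_convergent_def)
  have conv: "\<exists>t. (\<lambda>n. poset_density Q s (P n) (r n)) \<longlonglongrightarrow> t" if "finite_poset Q s" for Q :: "nat set" and s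
    using assms(2) that by (auto simp: poset_convergent_def convergent_def)
  have poset: "finite Q" "s \<subseteq> Q \<times> Q" "asym s" "irrefl s" if "finite_poset Q s" for Q :: "nat set" and s
    using that by (auto simp: finite_poset_def irrefl_def intro!: asymI dest: transD)
  from poset_sequence_edge_limit[OF assms(1) inf]
  obtain a e where "edge_limit a e"
    and step_lim: "\<forall>(Q :: nat set) s t. finite Q \<and> s \<subseteq> Q \<times> Q \<and> asym s \<and>
      (\<lambda>n. poset_density Q s (P n) (r n)) \<longlonglongrightarrow> t \<longrightarrow>
      (\<lambda>m. step_density (3 ^ m) (a m) (e m) Q s) \<longlonglongrightarrow> t"
    by blast
  from this(1) interpret edge_limit a e .
  obtain W q where W: "bounded_measurable W" "\<And>p. W p \<in> {0..1}" and q: "strict_mono q"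
    and lim: "AE p in unit_square_measure. (\<lambda>n. step_kernel (q n) p) \<longlonglongrightarrow> W p"
    and dev: "AE p in unit_square_measure. (\<lambda>n. deviation W (q n) p) \<longlonglongrightarrow> 0"
    by (rule limit_kernel_exists) blast
  \<comment> \<open>Stated for any almost everywhere limit \<open>V\<close>, since it serves twice:
    for \<open>W\<close>, to obtain the triple condition, and for \<open>regular_kernel\<close>, to
    obtain the conclusion.\<close>
  have density: "kernel_density Q s unit_interval_measure (\<lambda>x y. V (x, y)) = t"
    if Q: "finite Q" "s \<subseteq> Q \<times> Q" "asym s" and t: "(\<lambda>n. poset_density Q s (P n) (r n)) \<longlonglongrightarrow> t"
      and V: "bounded_measurable V" "AE p in unit_square_measure. (\<lambda>n. step_kernel (q n) p) \<longlonglongrightarrow> V p"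
    for Q :: "nat set" and s t V
  proof (rule LIMSEQ_unique)
    show "(\<lambda>n. step_density (3 ^ q n) (a (q n)) (e (q n)) Q s)
        \<longlonglongrightarrow> kernel_density Q s unit_interval_measure (\<lambda>x y. V (x, y))"
      using Q by (intro step_density_tendsto_kernel_density V) (auto simp: irrefl_def dest: asymD)
    have "(\<lambda>m. step_density (3 ^ m) (a m) (e m) Q s) \<longlonglongrightarrow> t" using step_lim Q t by blast
    from LIMSEQ_subseq_LIMSEQ[OF this q]
    show "(\<lambda>n. step_density (3 ^ q n) (a (q n)) (e (q n)) Q s) \<longlonglongrightarrow> t" by (simp add: o_def)
  qed
  define Q3 where "Q3 = {0, 1, 2 :: nat}"
  define path where "path = {(0, 1), (1, 2) :: nat \<times> nat}"
  define chain where "chain = {(0, 1), (1, 2), (0, 2) :: nat \<times> nat}"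
  have chain: "finite_poset Q3 chain"
    by (auto simp: finite_poset_def Q3_def chain_def irrefl_def intro!: transI)
  have path: "path \<subseteq> Q3 \<times> Q3" "asym path"
    by (auto simp: Q3_def path_def intro!: asymI)
  \<comment> \<open>Transitivity of each poset supplies the third relation of the chain, so path and
    chain have the same homomorphisms.\<close>
  have "poset_homs Q3 path (P n) (r n) = poset_homs Q3 chain (P n) (r n)" for n
    using transD[OF tr[of n]] by (auto simp: poset_homs_def Q3_def path_def chain_def)
  then have same: "poset_density Q3 path (P n) (r n) = poset_density Q3 chain (P n) (r n)" for n
    by (simp add: poset_density_def)
  obtain t where t: "(\<lambda>n. poset_density Q3 chain (P n) (r n)) \<longlonglongrightarrow> t" using conv[OF chain] by blast
  have "kernel_density Q3 path unit_interval_measure (\<lambda>x y. W (x, y))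
      = kernel_density Q3 chain unit_interval_measure (\<lambda>x y. W (x, y))"
    using density[OF poset(1)[OF chain] path _ W(1) lim, of t] density[OF poset(1-3)[OF chain] t W(1) lim] t
    by (simp add: same)
  then have triple: "AE p in unit_square_measure. AE y in unit_interval_measure.
      W (fst p, y) = 0 \<or> W (y, snd p) = 0 \<or> W p = 1"
    unfolding Q3_def path_def chain_def by (rule AE_triple_from_densities[OF W])
  interpret edge_limit_kernel a e W q
    by unfold_locales (use W q lim dev triple in auto)
  have "(\<lambda>n. poset_density Q s (P n) (r n)) \<longlonglongrightarrow> kernel_density Q s unit_interval_measure regular_kernel"
    if Qs: "finite_poset Q s" for Q :: "nat set" and s
  proof -
    obtain t where t: "(\<lambda>n. poset_density Q s (P n) (r n)) \<longlonglongrightarrow> t" using conv[OF Qs] by blast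
    from density[OF poset(1-3)[OF Qs] t regular_kernel_bounded_measurable step_kernel_AE_regular] t
    show ?thesis by simp
  qed
  with poset_kernel_regular show ?thesis by blast
qed

end
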